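(* Let $u:M\times[a,b]\to\mathbb{R}$ be a smooth function, with $u(\cdot,t)\not\equiv0$ for every $t\in[a,b]$, satisfying $$|u_t-\mathcal{L}u|\le\psi(t)\left(|u|+\sqrt{T(\nabla u,\nabla u)}\right)\quad\text{on } M\times[a,b],$$ where $\psi$ is a function of $t\in[a,b]$ only. Then, for all $t\in[a,b]$, $$\psi^2(t)\ \ge\ \left[\log(1-U(t))\right]'.$$
   Context: $(M,g)$ is a closed (compact, without boundary) Riemannian manifold with Riemannian volume form $d\nu$, $f\in C^\infty(M)$ is a real-valued function, and $d\mu=e^{-f}d\nu$ is the weighted measure. $T$ is a smooth symmetric positive definite $(1,1)$-tensor on $M$ (independent of time); for vector fields $X,Y$ write $T(X,Y)=\langle T(X),Y\rangle$. The operator $\mathcal{L}$ acts on $C^2$ functions by $$\mathcal{L}u=\mathrm{div}_f(T(\nabla u))=e^{f}\,\mathrm{div}(e^{-f}T(\nabla u))=\mathrm{div}(T(\nabla u))-\langle\nabla f,T(\nabla u)\rangle .$$ For a function $u$ on $M\times[a,b]$, $\nabla$ and $\mathcal{L}$ act in the $M$-variable, and $$D(t)=-\int_M T(\nabla u,\nabla u)\,d\mu=\int_M u\,\mathcal{L}u\,d\mu,\qquad I(t)=\int_M u^2\,d\mu,\qquad U(t)=\frac{D(t)}{I(t)}.$$ The prime denotes the derivative in $t$. *)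

theory Defs
  imports "HOL-Analysis.Analysis"
begin

section \<open>Smooth functions\<close>

text \<open>\<open>k\<close>-fold continuous differentiability; only meaningful on open sets, since the derivatives
  are taken in the full space.\<close>

primrec Ck_on ::
    "nat \<Rightarrow> 'a::euclidean_space set \<Rightarrow> ('a \<Rightarrow> 'b::real_normed_vector) \<Rightarrow> bool" where
  "Ck_on 0 W F \<longleftrightarrow> continuous_on W F"
| "Ck_on (Suc k) W F \<longleftrightarrow>
     F differentiable_on W \<and> (\<forall>v. Ck_on k W (\<lambda>x. frechet_derivative F (at x) v))"

text \<open>On an arbitrary set (e.g. \<open>V \<times> {a..b}\<close>) smoothness means local extendability to a
  smooth function on an open set; on an open set this is ordinary smoothness.\<close>

definition smooth_on ::
    "'a::euclidean_space set \<Rightarrow> ('a \<Rightarrow> 'b::real_normed_vector) \<Rightarrow> bool" where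
  "smooth_on S F \<longleftrightarrow>
     (\<forall>x\<in>S. \<exists>W G. open W \<and> x \<in> W \<and> (\<forall>k. Ck_on k W G) \<and> (\<forall>y\<in>S \<inter> W. F y = G y))"


section \<open>Smooth manifolds\<close>

text \<open>A chart is a pair of its domain and the coordinate map; values of the coordinate map
  outside the domain are irrelevant.\<close>

type_synonym ('a, 'n) chart = "'a set \<times> ('a \<Rightarrow> real ^ 'n)"

definition chart_dom :: "('a, 'n) chart \<Rightarrow> 'a set" where
  "chart_dom c = fst c"

definition chart_map :: "('a, 'n) chart \<Rightarrow> 'a \<Rightarrow> real ^ 'n" where
  "chart_map c = snd c"

definition chart_inv :: "('a, 'n) chart \<Rightarrow> real ^ 'n \<Rightarrow> 'a" where
  "chart_inv c = inv_into (chart_dom c) (chart_map c)"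

definition chart_img :: "('a, 'n) chart \<Rightarrow> (real ^ 'n) set" where
  "chart_img c = chart_map c ` chart_dom c"

definition transition :: "('a, 'n) chart \<Rightarrow> ('a, 'n) chart \<Rightarrow> real ^ 'n \<Rightarrow> real ^ 'n" where
  "transition c d = chart_map d \<circ> chart_inv c"

definition transition_jacobian ::
    "('a, 'n::finite) chart \<Rightarrow> ('a, 'n) chart \<Rightarrow> 'a \<Rightarrow> real ^ 'n ^ 'n" where
  "transition_jacobian c d p = jacobian (transition c d) (at (chart_map c p))"

locale smooth_manifold =
  fixes M :: "'a topology" and \<A> :: "('a, 'n::finite) chart set"
  assumes hausdorff: "Hausdorff_space M"
    and second_countable: "second_countable M"
    and chart_dom_open: "c \<in> \<A> \<Longrightarrow> openin M (chart_dom c)"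
    and chart_img_open: "c \<in> \<A> \<Longrightarrow> open (chart_img c)"
    and chart_homeomorphic:
      "c \<in> \<A> \<Longrightarrow>
        homeomorphic_map (subtopology M (chart_dom c)) (top_of_set (chart_img c)) (chart_map c)"
    and charts_cover: "(\<Union>c\<in>\<A>. chart_dom c) = topspace M"
    and transition_smooth:
      "c \<in> \<A> \<Longrightarrow> d \<in> \<A> \<Longrightarrow>
        smooth_on (chart_map c ` (chart_dom c \<inter> chart_dom d)) (transition c d)"

definition smooth_function :: "('a, 'n::finite) chart set \<Rightarrow> ('a \<Rightarrow> real) \<Rightarrow> bool" where
  "smooth_function \<A> h \<longleftrightarrow> (\<forall>c\<in>\<A>. smooth_on (chart_img c) (h \<circ> chart_inv c))"

definition smooth_function_on_interval ::
    "('a, 'n::finite) chart set \<Rightarrow> real \<Rightarrow> real \<Rightarrow> ('a \<Rightarrow> real \<Rightarrow> real) \<Rightarrow> bool" where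
  "smooth_function_on_interval \<A> a b u \<longleftrightarrow>
     (\<forall>c\<in>\<A>. smooth_on (chart_img c \<times> {a..b}) (\<lambda>(x, t). u (chart_inv c x) t))"


section \<open>Tensor fields and Riemannian metrics\<close>

text \<open>Tensor fields are given by their components in each chart, as functions of the point:
  \<open>Y c p\<close> is the component vector of the vector field \<open>Y\<close> at \<open>p\<close> in the chart \<open>c\<close>, and
  2-tensors and endomorphism fields have component matrices \<open>g c p\<close>, \<open>T c p\<close>. Being a tensor is
  the transformation law under change of charts.\<close>

type_synonym ('a, 'n) vector_field = "('a, 'n) chart \<Rightarrow> 'a \<Rightarrow> real ^ 'n"
type_synonym ('a, 'n) matrix_field = "('a, 'n) chart \<Rightarrow> 'a \<Rightarrow> real ^ 'n ^ 'n"

definition smooth_components ::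
    "('a, 'n::finite) chart set \<Rightarrow> ('a, 'n) matrix_field \<Rightarrow> bool" where
  "smooth_components \<A> S \<longleftrightarrow> (\<forall>c\<in>\<A>. smooth_on (chart_img c) (S c \<circ> chart_inv c))"

definition tensor02 :: "('a, 'n::finite) chart set \<Rightarrow> ('a, 'n) matrix_field \<Rightarrow> bool" where
  "tensor02 \<A> g \<longleftrightarrow>
     (\<forall>c\<in>\<A>. \<forall>d\<in>\<A>. \<forall>p\<in>chart_dom c \<inter> chart_dom d.
        g c p = transpose (transition_jacobian c d p) ** g d p ** transition_jacobian c d p)"

definition tensor11 :: "('a, 'n::finite) chart set \<Rightarrow> ('a, 'n) matrix_field \<Rightarrow> bool" where
  "tensor11 \<A> T \<longleftrightarrow>
     (\<forall>c\<in>\<A>. \<forall>d\<in>\<A>. \<forall>p\<in>chart_dom c \<inter> chart_dom d.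
        T d p ** transition_jacobian c d p = transition_jacobian c d p ** T c p)"

locale riemannian_manifold = smooth_manifold M \<A>
  for M :: "'a topology" and \<A> :: "('a, 'n::finite) chart set" +
  fixes g :: "('a, 'n) matrix_field"
  assumes metric_tensor: "tensor02 \<A> g"
    and metric_smooth: "smooth_components \<A> g"
    and metric_symmetric: "c \<in> \<A> \<Longrightarrow> p \<in> chart_dom c \<Longrightarrow> transpose (g c p) = g c p"
    and metric_positive: "c \<in> \<A> \<Longrightarrow> p \<in> chart_dom c \<Longrightarrow> v \<noteq> 0 \<Longrightarrow> 0 < v \<bullet> (g c p *v v)"

locale closed_riemannian_manifold = riemannian_manifold +
  assumes compact: "compact_space M"

text \<open>Symmetry and positivity of an endomorphism field are with respect to \<open>g\<close>.\<close>

definition smooth_spd_tensor11 ::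
    "('a, 'n::finite) chart set \<Rightarrow> ('a, 'n) matrix_field \<Rightarrow> ('a, 'n) matrix_field \<Rightarrow> bool" where
  "smooth_spd_tensor11 \<A> g T \<longleftrightarrow>
     tensor11 \<A> T \<and> smooth_components \<A> T \<and>
     (\<forall>c\<in>\<A>. \<forall>p\<in>chart_dom c.
        (\<forall>v w. (T c p *v v) \<bullet> (g c p *v w) = v \<bullet> (g c p *v (T c p *v w))) \<and>
        (\<forall>v. v \<noteq> 0 \<longrightarrow> 0 < (T c p *v v) \<bullet> (g c p *v v)))"

text \<open>Scalars computed from components do not depend on the chart; they are evaluated in an
  arbitrary chart around the point.\<close>

definition chart_at :: "('a, 'n) chart set \<Rightarrow> 'a \<Rightarrow> ('a, 'n) chart" where
  "chart_at \<A> p = (SOME c. c \<in> \<A> \<and> p \<in> chart_dom c)"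

definition riem_inner ::
    "('a, 'n::finite) chart set \<Rightarrow> ('a, 'n) matrix_field \<Rightarrow>
     ('a, 'n) vector_field \<Rightarrow> ('a, 'n) vector_field \<Rightarrow> 'a \<Rightarrow> real" where
  "riem_inner \<A> g Y Z p = (let c = chart_at \<A> p in Y c p \<bullet> (g c p *v Z c p))"

definition tensor_apply ::
    "('a, 'n::finite) matrix_field \<Rightarrow> ('a, 'n) vector_field \<Rightarrow> ('a, 'n) vector_field" where
  "tensor_apply T Y c p = T c p *v Y c p"

definition tensor_form ::
    "('a, 'n::finite) chart set \<Rightarrow> ('a, 'n) matrix_field \<Rightarrow> ('a, 'n) matrix_field \<Rightarrow>
     ('a, 'n) vector_field \<Rightarrow> ('a, 'n) vector_field \<Rightarrow> 'a \<Rightarrow> real" where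
  "tensor_form \<A> g T Y Z = riem_inner \<A> g (tensor_apply T Y) Z"


section \<open>Gradient, divergence and the weighted operator\<close>

definition partial_deriv ::
    "('a, 'n::finite) chart \<Rightarrow> 'n \<Rightarrow> ('a \<Rightarrow> real) \<Rightarrow> 'a \<Rightarrow> real" where
  "partial_deriv c i h p =
     frechet_derivative (h \<circ> chart_inv c) (at (chart_map c p)) (axis i 1)"

definition gradient ::
    "('a, 'n::finite) matrix_field \<Rightarrow> ('a \<Rightarrow> real) \<Rightarrow> ('a, 'n) vector_field" where
  "gradient g h c p = matrix_inv (g c p) *v (\<chi> i. partial_deriv c i h p)"

definition volume_density :: "('a, 'n::finite) matrix_field \<Rightarrow> ('a, 'n) chart \<Rightarrow> 'a \<Rightarrow> real" where
  "volume_density g c p = sqrt (det (g c p))"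

definition divergence ::
    "('a, 'n::finite) chart set \<Rightarrow> ('a, 'n) matrix_field \<Rightarrow> ('a, 'n) vector_field \<Rightarrow>
     'a \<Rightarrow> real" where
  "divergence \<A> g Y p =
     (let c = chart_at \<A> p in
       (\<Sum>i\<in>UNIV. partial_deriv c i (\<lambda>q. volume_density g c q * Y c q $ i) p)
         / volume_density g c p)"

definition weighted_divergence ::
    "('a, 'n::finite) chart set \<Rightarrow> ('a, 'n) matrix_field \<Rightarrow> ('a \<Rightarrow> real) \<Rightarrow>
     ('a, 'n) vector_field \<Rightarrow> 'a \<Rightarrow> real" where
  "weighted_divergence \<A> g f Y p =
     exp (f p) * divergence \<A> g (\<lambda>c q. exp (- f q) *\<^sub>R Y c q) p"

definition weighted_operator ::
    "('a, 'n::finite) chart set \<Rightarrow> ('a, 'n) matrix_field \<Rightarrow> ('a \<Rightarrow> real) \<Rightarrow>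
     ('a, 'n) matrix_field \<Rightarrow> ('a \<Rightarrow> real) \<Rightarrow> 'a \<Rightarrow> real" where
  "weighted_operator \<A> g f T h = weighted_divergence \<A> g f (tensor_apply T (gradient g h))"


section \<open>Riemannian measure and the frequency function\<close>

text \<open>The Riemannian measure is the Borel measure which in every chart has density
  \<open>sqrt (det g)\<close> with respect to Lebesgue measure. On a Riemannian manifold there is exactly one
  such measure: different charts agree on overlaps by the change of variables formula.\<close>

definition is_riemannian_measure ::
    "'a topology \<Rightarrow> ('a, 'n::finite) chart set \<Rightarrow> ('a, 'n) matrix_field \<Rightarrow> 'a measure \<Rightarrow> bool" where
  "is_riemannian_measure M \<A> g \<nu> \<longleftrightarrow>
     space \<nu> = topspace M \<and>
     sets \<nu> = sigma_sets (topspace M) {U. openin M U} \<and>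
     (\<forall>c\<in>\<A>. \<forall>B\<in>sets \<nu>. B \<subseteq> chart_dom c \<longrightarrow>
        emeasure \<nu> B =
          (\<integral>\<^sup>+x\<in>chart_map c ` B. ennreal (volume_density g c (chart_inv c x)) \<partial>lborel))"

definition weighted_measure :: "'a measure \<Rightarrow> ('a \<Rightarrow> real) \<Rightarrow> 'a measure" where
  "weighted_measure \<nu> f = density \<nu> (\<lambda>p. ennreal (exp (- f p)))"

definition frequency_D ::
    "('a, 'n::finite) chart set \<Rightarrow> ('a, 'n) matrix_field \<Rightarrow> ('a, 'n) matrix_field \<Rightarrow>
     'a measure \<Rightarrow> ('a \<Rightarrow> real \<Rightarrow> real) \<Rightarrow> real \<Rightarrow> real" where
  "frequency_D \<A> g T \<mu> u t =
     - (\<integral>p. tensor_form \<A> g T (gradient g (\<lambda>q. u q t)) (gradient g (\<lambda>q. u q t)) p \<partial>\<mu>)"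

definition frequency_I :: "'a measure \<Rightarrow> ('a \<Rightarrow> real \<Rightarrow> real) \<Rightarrow> real \<Rightarrow> real" where
  "frequency_I \<mu> u t = (\<integral>p. (u p t)\<^sup>2 \<partial>\<mu>)"

definition frequency_U ::
    "('a, 'n::finite) chart set \<Rightarrow> ('a, 'n) matrix_field \<Rightarrow> ('a, 'n) matrix_field \<Rightarrow>
     'a measure \<Rightarrow> ('a \<Rightarrow> real \<Rightarrow> real) \<Rightarrow> real \<Rightarrow> real" where
  "frequency_U \<A> g T \<mu> u t = frequency_D \<A> g T \<mu> u t / frequency_I \<mu> u t"

end

theory Submission
  imports Defs
begin

text \<open>Write \<open>L\<close> for the operator, \<open>w = u\<^sub>t - L u\<close> for the error of the equation, and all
integrals with respect to the weighted measure \<open>\<mu>\<close>. Differentiating the two integrals gives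
\<open>D' = 2 \<integral> u\<^sub>t L u\<close> and \<open>I' = 2 \<integral> u\<^sub>t u\<close>. Substituting \<open>u\<^sub>t = (L u + w/2) + w/2\<close> into
\<open>I\<^sup>2 U' = D' I - D I'\<close> completes two squares, and the Cauchy--Schwarz inequality for \<open>u\<close> and
\<open>L u + w/2\<close> leaves \<open>U' \<ge> - (\<integral> w\<^sup>2) / (2 I)\<close>. The differential inequality bounds \<open>\<integral> w\<^sup>2\<close> by
\<open>2 \<psi>\<^sup>2 (I - D)\<close>, because \<open>(x + y)\<^sup>2 \<le> 2 (x\<^sup>2 + y\<^sup>2)\<close>; hence \<open>U' \<ge> - \<psi>\<^sup>2 (1 - U)\<close>, which is the
claim. This is \<open>log_frequency_derivative\<close>.

The analytic content is Green's identity \<open>\<integral> T(\<nabla>w, \<nabla>v) = - \<integral> v L w\<close>, lemma \<open>green\<close>. In one chart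
and for compactly supported \<open>v\<close> it says that the derivative of a compactly supported function
has integral zero, which follows from the translation invariance of Lebesgue measure. The local
identities are added up by means of finitely many bump functions. The divergence is given by a
coordinate formula, and that its value does not depend on the chart need not be computed: by the
local Green identity, two charts give operators with the same integrals against every test
function supported in the overlap, and both are continuous (\<open>chart_operator_le\<close>). Only the first
order expression \<open>T(\<nabla>w, \<nabla>v)\<close> is transformed explicitly (\<open>chart_pairing_independent\<close>).

Green's identity and the symmetry of \<open>T\<close> also give
\<open>D(s) - D(t) = \<integral> (u(s) - u(t)) (L u(s) + L u(t))\<close>, of the same form as
\<open>I(s) - I(t) = \<integral> (u(s) - u(t)) (u(s) + u(t))\<close>. So one dominated convergence argument
(\<open>has_derivative_of_quadratic\<close>) yields both derivatives, and no gradient is ever differentiated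
in time.\<close>

section \<open>Continuously differentiable functions\<close>

text \<open>The derivative is evaluated at fixed vectors; in finite dimension the continuity of all
these directional derivatives is continuity of the derivative itself. Differentiability is in
the full space, so the notion is meant for open sets.\<close>

definition C1_on :: "'a::real_normed_vector set \<Rightarrow> ('a \<Rightarrow> 'b::real_normed_vector) \<Rightarrow> bool" where
  "C1_on S F \<longleftrightarrow> (\<forall>x\<in>S. F differentiable (at x)) \<and>
     (\<forall>v. continuous_on S (\<lambda>x. frechet_derivative F (at x) v))"

lemma frechet_derivative_has_derivative:
  assumes "(F has_derivative F') (at x)"
  shows "frechet_derivative F (at x) = F'"
  using frechet_derivative_at[OF assms] by simp

lemma frechet_derivative_cong_open:
  assumes "open U" "x \<in> U" "\<And>y. y \<in> U \<Longrightarrow> F y = G y"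
  shows "frechet_derivative F (at x) = frechet_derivative G (at x)"
proof -
  have "(F has_derivative F') (at x) \<longleftrightarrow> (G has_derivative F') (at x)" for F'
    using has_derivative_transform_within_open[OF _ assms(1,2), of F F' UNIV G]
      has_derivative_transform_within_open[OF _ assms(1,2), of G F' UNIV F] assms(3) by auto
  then show ?thesis by (simp add: frechet_derivative_def)
qed

lemma differentiable_cong_open:
  assumes "open U" "x \<in> U" "\<And>y. y \<in> U \<Longrightarrow> F y = G y" "G differentiable (at x)"
  shows "F differentiable (at x)"
  using assms(4) has_derivative_transform_within_open[OF _ assms(1,2), of G _ UNIV F] assms(3)
  unfolding differentiable_def by auto

lemma C1_onI:
  assumes "\<And>x. x \<in> S \<Longrightarrow> (F has_derivative F' x) (at x)"
    and "\<And>v. continuous_on S (\<lambda>x. F' x v)"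
  shows "C1_on S F"
  unfolding C1_on_def
proof (intro conjI ballI allI)
  fix x assume "x \<in> S" then show "F differentiable at x"
    using assms(1) unfolding differentiable_def by blast
next
  fix v show "continuous_on S (\<lambda>x. frechet_derivative F (at x) v)"
    using assms(2)[of v] by (rule continuous_on_eq)
      (simp add: frechet_derivative_has_derivative[OF assms(1)])
qed

lemma C1_onD:
  assumes "C1_on S F" "x \<in> S"
  shows "(F has_derivative frechet_derivative F (at x)) (at x)"
  using assms unfolding C1_on_def frechet_derivative_works by blast

lemma C1_on_continuous_deriv: "C1_on S F \<Longrightarrow> continuous_on S (\<lambda>x. frechet_derivative F (at x) v)"
  unfolding C1_on_def by blast

lemma C1_on_continuous: "C1_on S F \<Longrightarrow> continuous_on S F"
  by (intro continuous_at_imp_continuous_on ballI has_derivative_continuous[OF C1_onD])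

lemma C1_on_subset: "C1_on S F \<Longrightarrow> S' \<subseteq> S \<Longrightarrow> C1_on S' F"
  unfolding C1_on_def using continuous_on_subset by blast

lemma C1_on_cong_open:
  assumes "C1_on S F" "open S" "\<And>x. x \<in> S \<Longrightarrow> G x = F x"
  shows "C1_on S G"
  unfolding C1_on_def
proof (intro conjI ballI allI)
  fix x assume "x \<in> S" then show "G differentiable at x"
    using assms differentiable_cong_open[of S x G F] unfolding C1_on_def by blast
next
  fix v show "continuous_on S (\<lambda>x. frechet_derivative G (at x) v)"
    using C1_on_continuous_deriv[OF assms(1), of v] by (rule continuous_on_eq)
      (simp add: frechet_derivative_cong_open[OF assms(2) _ assms(3)])
qed

lemma C1_on_local:
  assumes "\<And>x. x \<in> S \<Longrightarrow> \<exists>U. open U \<and> x \<in> U \<and> C1_on (U \<inter> S) F"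
  shows "C1_on S F"
  unfolding C1_on_def
proof (intro conjI ballI allI)
  fix x assume "x \<in> S" then show "F differentiable at x"
    using assms unfolding C1_on_def by blast
next
  fix v show "continuous_on S (\<lambda>x. frechet_derivative F (at x) v)"
    unfolding continuous_on_eq_continuous_within
  proof
    fix x assume x: "x \<in> S"
    then obtain U where U: "open U" "x \<in> U" "C1_on (U \<inter> S) F" using assms by blast
    then have "continuous (at x within U \<inter> S) (\<lambda>x. frechet_derivative F (at x) v)"
      using x C1_on_continuous_deriv[OF U(3)] by (simp add: continuous_on_eq_continuous_within)
    then show "continuous (at x within S) (\<lambda>x. frechet_derivative F (at x) v)"
      using at_within_nhd[OF U(2,1), of S "U \<inter> S"] by (simp add: Int_ac continuous_within)
  qed
qed

lemma C1_on_open_Un: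
  assumes "C1_on S F" "C1_on S' F" "open S" "open S'"
  shows "C1_on (S \<union> S') F"
proof (rule C1_on_local)
  fix x assume "x \<in> S \<union> S'"
  then show "\<exists>U. open U \<and> x \<in> U \<and> C1_on (U \<inter> (S \<union> S')) F"
  proof
    assume "x \<in> S"
    then show ?thesis using assms(3) C1_on_subset[OF assms(1)] by (intro exI[of _ S]) auto
  next
    assume "x \<in> S'"
    then show ?thesis using assms(4) C1_on_subset[OF assms(2)] by (intro exI[of _ S']) auto
  qed
qed

lemma C1_on_const [intro]: "C1_on S (\<lambda>x. c)"
  by (rule C1_onI[where F'="\<lambda>x v. 0"]) auto

text \<open>The set where \<open>k\<close> is defined and the complement of its support are open, cover everything,
and on both the extension is \<open>C\<^sup>1\<close>.\<close>

lemma C1_on_extend_by_zero: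
  fixes k :: "'a::real_normed_vector \<Rightarrow> real"
  assumes k: "C1_on V k" "open V" and K: "closed K" "K \<subseteq> V" "\<And>x. x \<in> V \<Longrightarrow> x \<notin> K \<Longrightarrow> k x = 0"
  shows "C1_on UNIV (\<lambda>x. if x \<in> V then k x else 0)"
proof -
  have "C1_on V (\<lambda>x. if x \<in> V then k x else 0)" by (rule C1_on_cong_open[OF k]) simp
  moreover have "C1_on (- K) (\<lambda>x. if x \<in> V then k x else 0)"
    by (rule C1_on_cong_open[OF C1_on_const[of _ 0]]) (use K in auto)
  ultimately have "C1_on (V \<union> - K) (\<lambda>x. if x \<in> V then k x else 0)"
    by (rule C1_on_open_Un) (use k K in auto)
  moreover have "V \<union> - K = UNIV" using K(2) by blast
  ultimately show ?thesis by simp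
qed

lemma C1_on_bounded_linear:
  assumes "bounded_linear B" "C1_on S F" shows "C1_on S (\<lambda>x. B (F x))"
  by (rule C1_onI[where F'="\<lambda>x v. B (frechet_derivative F (at x) v)"])
    (auto intro!: bounded_linear.has_derivative[OF assms(1)] C1_onD[OF assms(2)]
      bounded_linear.continuous_on[OF assms(1)] C1_on_continuous_deriv[OF assms(2)])

lemma C1_on_add [intro]:
  assumes "C1_on S F" "C1_on S G" shows "C1_on S (\<lambda>x. F x + G x)"
  by (rule C1_onI[OF has_derivative_add[OF C1_onD[OF assms(1)] C1_onD[OF assms(2)]]])
    (auto intro!: continuous_intros C1_on_continuous_deriv assms)

lemma C1_on_mult [intro]:
  fixes F G :: "'a::real_normed_vector \<Rightarrow> real"
  assumes "C1_on S F" "C1_on S G" shows "C1_on S (\<lambda>x. F x * G x)"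
  by (rule C1_onI[OF has_derivative_mult[OF C1_onD[OF assms(1)] C1_onD[OF assms(2)]]])
    (auto intro!: continuous_intros C1_on_continuous_deriv[OF assms(1)]
      C1_on_continuous_deriv[OF assms(2)] C1_on_continuous[OF assms(1)] C1_on_continuous[OF assms(2)])

lemma C1_on_sum:
  assumes "\<And>i. i \<in> I \<Longrightarrow> C1_on S (F i)" shows "C1_on S (\<lambda>x. \<Sum>i\<in>I. F i x)"
  using assms by (induction I rule: infinite_finite_induct) (auto intro!: C1_on_add C1_on_const)

lemma C1_on_prod:
  fixes F :: "'i \<Rightarrow> 'a::real_normed_vector \<Rightarrow> real"
  assumes "\<And>i. i \<in> I \<Longrightarrow> C1_on S (F i)" shows "C1_on S (\<lambda>x. \<Prod>i\<in>I. F i x)"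
  using assms by (induction I rule: infinite_finite_induct) (auto intro!: C1_on_mult C1_on_const)

lemma C1_on_compose_real:
  fixes F :: "'a::real_normed_vector \<Rightarrow> real" and h h' :: "real \<Rightarrow> real"
  assumes F: "C1_on S F" and h: "\<And>y. y \<in> F ` S \<Longrightarrow> (h has_real_derivative h' y) (at y)"
    and h': "continuous_on (F ` S) h'"
  shows "C1_on S (\<lambda>x. h (F x))"
proof (rule C1_onI)
  fix x assume x: "x \<in> S"
  show "((\<lambda>x. h (F x)) has_derivative (\<lambda>v. h' (F x) * frechet_derivative F (at x) v)) (at x)"
    using has_derivative_compose[OF C1_onD[OF F x]] h[of "F x"] x
    by (auto simp: has_field_derivative_def)
next
  fix v show "continuous_on S (\<lambda>x. h' (F x) * frechet_derivative F (at x) v)"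
    using continuous_on_compose[OF C1_on_continuous[OF F] h']
    by (auto intro!: continuous_intros C1_on_continuous_deriv[OF F] simp: o_def)
qed

text \<open>Continuity of the derivative is known for fixed directions only, whereas the chain rule
evaluates the outer derivative in a moving direction; expanding that direction in the basis
reduces the one to the other.\<close>

lemma C1_on_compose:
  fixes F :: "'a::real_normed_vector \<Rightarrow> 'b::euclidean_space"
    and G :: "'b \<Rightarrow> 'c::real_normed_vector"
  assumes F: "C1_on S F" and G: "C1_on T G" and sub: "F ` S \<subseteq> T"
  shows "C1_on S (\<lambda>x. G (F x))"
proof (rule C1_onI)
  fix x assume x: "x \<in> S"
  show "((\<lambda>x. G (F x)) has_derivative
      (\<lambda>v. frechet_derivative G (at (F x)) (frechet_derivative F (at x) v))) (at x)"
    by (rule has_derivative_compose[OF C1_onD[OF F x] C1_onD[OF G]]) (use sub x in auto)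
next
  fix v
  let ?R = "\<lambda>x. \<Sum>b\<in>Basis. (frechet_derivative F (at x) v \<bullet> b) *\<^sub>R frechet_derivative G (at (F x)) b"
  have "continuous_on S (\<lambda>x. frechet_derivative G (at (F x)) b)" for b
    using continuous_on_compose2[OF C1_on_continuous_deriv[OF G, of b] C1_on_continuous[OF F] sub]
    by simp
  then have "continuous_on S ?R"
    by (intro continuous_intros C1_on_continuous_deriv[OF F]) auto
  then show "continuous_on S (\<lambda>x. frechet_derivative G (at (F x)) (frechet_derivative F (at x) v))"
  proof (rule continuous_on_eq)
    fix x assume x: "x \<in> S"
    interpret linear "frechet_derivative G (at (F x))"
      using has_derivative_linear[OF C1_onD[OF G, of "F x"]] sub x by blast
    show "?R x = frechet_derivative G (at (F x)) (frechet_derivative F (at x) v)"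
      by (metis (no_types, lifting) euclidean_representation scale sum sum.cong)
  qed
qed

lemma C1_on_inverse:
  fixes F :: "'a::real_normed_vector \<Rightarrow> real"
  assumes "C1_on S F" "\<And>x. x \<in> S \<Longrightarrow> F x \<noteq> 0" shows "C1_on S (\<lambda>x. inverse (F x))"
proof (rule C1_on_compose_real[OF assms(1)])
  show "(inverse has_real_derivative - (inverse y ^ Suc (Suc 0))) (at y)" if "y \<in> F ` S" for y
    using that assms(2) by (intro DERIV_inverse) auto
  show "continuous_on (F ` S) (\<lambda>y. - (inverse y ^ Suc (Suc 0)))"
    using assms(2) by (intro continuous_intros) auto
qed

lemma C1_on_divide:
  fixes F G :: "'a::real_normed_vector \<Rightarrow> real"
  assumes "C1_on S F" "C1_on S G" "\<And>x. x \<in> S \<Longrightarrow> G x \<noteq> 0" shows "C1_on S (\<lambda>x. F x / G x)"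
  unfolding divide_inverse by (intro C1_on_mult C1_on_inverse assms)

lemma C1_on_sqrt:
  fixes F :: "'a::real_normed_vector \<Rightarrow> real"
  assumes "C1_on S F" "\<And>x. x \<in> S \<Longrightarrow> F x > 0" shows "C1_on S (\<lambda>x. sqrt (F x))"
proof (rule C1_on_compose_real[OF assms(1)])
  show "(sqrt has_real_derivative inverse (sqrt y) / 2) (at y)" if "y \<in> F ` S" for y
    using that assms(2) by (intro DERIV_real_sqrt) auto
  show "continuous_on (F ` S) (\<lambda>y. inverse (sqrt y) / 2)"
    using assms(2) by (intro continuous_intros) (auto simp: less_le)
qed

lemma C1_on_exp:
  fixes F :: "'a::real_normed_vector \<Rightarrow> real"
  assumes "C1_on S F" shows "C1_on S (\<lambda>x. exp (F x))"
  by (rule C1_on_compose_real[OF assms(1), where h'=exp]) (auto intro!: continuous_intros DERIV_exp)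

text \<open>The building block of the bump functions.\<close>

lemma C1_on_max_0_squared:
  fixes F :: "'a::real_normed_vector \<Rightarrow> real"
  assumes "C1_on S F" shows "C1_on S (\<lambda>x. (max 0 (F x))\<^sup>2)"
proof (rule C1_on_compose_real[OF assms])
  show "continuous_on (F ` S) (\<lambda>y. 2 * max 0 y)" by (intro continuous_intros)
  show "((\<lambda>y. (max 0 y)\<^sup>2) has_real_derivative 2 * max 0 y) (at y)" for y :: real
  proof -
    consider "y < 0" | "y = 0" | "y > 0" by linarith
    then show ?thesis
    proof cases
      case 1
      have "((\<lambda>y. 0) has_real_derivative 0) (at y)" by simp
      then have "((\<lambda>y. (max 0 y)\<^sup>2) has_real_derivative 0) (at y)"
        by (rule has_field_derivative_transform_within_open[where S="{..<0}"]) (use 1 in auto)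
      then show ?thesis using 1 by simp
    next
      case 2
      have "((\<lambda>h::real. max 0 h) \<longlongrightarrow> 0) (at 0)"
        using tendsto_max[OF tendsto_const[of 0] tendsto_ident_at[of "0::real" UNIV]] by simp
      then have "((\<lambda>h::real. ((max 0 (0 + h))\<^sup>2 - (max 0 0)\<^sup>2) / h) \<longlongrightarrow> 0) (at 0)"
        by (rule Lim_transform_eventually)
          (auto simp: eventually_at_filter power2_eq_square max_def intro!: always_eventually)
      then show ?thesis using 2 by (simp add: DERIV_def)
    next
      case 3
      have "((\<lambda>y. y\<^sup>2) has_real_derivative 2 * y) (at y)" by (auto intro!: derivative_eq_intros)
      then have "((\<lambda>y. (max 0 y)\<^sup>2) has_real_derivative 2 * y) (at y)"
        by (rule has_field_derivative_transform_within_open[where S="{0<..}"]) (use 3 in auto)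
      then show ?thesis using 3 by simp
    qed
  qed
qed

section \<open>Determinants, inverse matrices and positive definiteness\<close>

lemma C1_on_det:
  fixes F :: "'a::real_normed_vector \<Rightarrow> real^'n^'n"
  assumes "\<And>i j. C1_on S (\<lambda>x. F x $ i $ j)" shows "C1_on S (\<lambda>x. det (F x))"
  unfolding det_def by (intro C1_on_sum C1_on_mult C1_on_prod C1_on_const assms)

lemma matrix_inv_vector_mult_det_ne_0:
  fixes A :: "real^'n^'n"
  assumes "det A \<noteq> 0"
  shows "A *v (matrix_inv A *v v) = v" "matrix_inv A *v (A *v v) = v"
proof -
  obtain B where "A ** B = mat 1 \<and> B ** A = mat 1"
    using assms invertible_det_nz[of A] unfolding invertible_def by blast
  then have "A ** matrix_inv A = mat 1 \<and> matrix_inv A ** A = mat 1"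
    unfolding matrix_inv_def by (rule someI)
  then show "A *v (matrix_inv A *v v) = v" "matrix_inv A *v (A *v v) = v"
    by (simp_all add: matrix_vector_mul_assoc)
qed

lemma C1_on_matrix_inv:
  fixes F :: "'a::real_normed_vector \<Rightarrow> real^'n^'n"
  assumes F: "\<And>i j. C1_on S (\<lambda>x. F x $ i $ j)" and S: "open S"
    and nz: "\<And>x. x \<in> S \<Longrightarrow> det (F x) \<noteq> 0"
  shows "C1_on S (\<lambda>x. matrix_inv (F x) $ k $ l)"
proof (rule C1_on_cong_open[OF _ S])
  \<comment> \<open>Cramer's rule writes the entries of the inverse as quotients of determinants.\<close>
  let ?N = "\<lambda>x. \<chi> i j. if j = k then axis l 1 $ i else F x $ i $ j"
  show "C1_on S (\<lambda>x. det (?N x) / det (F x))"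
  proof (intro C1_on_divide C1_on_det F nz)
    show "C1_on S (\<lambda>x. ?N x $ i $ j)" for i j
      by (cases "j = k") (auto intro: F)
  qed
  fix x assume x: "x \<in> S"
  have "matrix_inv (F x) $ k $ l = (matrix_inv (F x) *v axis l 1) $ k"
    by (simp add: matrix_vector_mult_basis column_def)
  also have "F x *v (matrix_inv (F x) *v axis l 1) = axis l 1"
    by (rule matrix_inv_vector_mult_det_ne_0[OF nz[OF x]])
  then have "(matrix_inv (F x) *v axis l 1) $ k = det (?N x) / det (F x)"
    unfolding cramer[OF nz[OF x]] by simp
  finally show "matrix_inv (F x) $ k $ l = det (?N x) / det (F x)" .
qed

text \<open>Needed for the volume density, the square root of this determinant, to be positive and
\<open>C\<^sup>1\<close>.\<close>

lemma det_pos_of_positive_definite: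
  fixes G :: "real^'n^'n"
  assumes pos: "\<And>v. v \<noteq> 0 \<Longrightarrow> 0 < v \<bullet> (G *v v)"
  shows "0 < det G"
proof -
  \<comment> \<open>The segment from the identity to \<open>G\<close> stays positive definite, hence invertible, so the
    determinant cannot change its sign along it.\<close>
  define H where "H s = (\<chi> i j. (1 - s) * (mat 1 :: real^'n^'n) $ i $ j + s * G $ i $ j)" for s
  have Hv: "H s *v v = (1 - s) *\<^sub>R v + s *\<^sub>R (G *v v)" for s v
  proof -
    have "H s = (1 - s) *\<^sub>R mat 1 + s *\<^sub>R G" by (simp add: H_def vec_eq_iff)
    then show ?thesis
      by (simp add: matrix_vector_mult_add_rdistrib scaleR_matrix_vector_assoc[symmetric])
  qed
  have nz: "det (H s) \<noteq> 0" if s: "0 \<le> s" "s \<le> 1" for s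
  proof
    assume "det (H s) = 0"
    then have "\<not> invertible (H s)" by (simp add: invertible_det_nz)
    then have "\<not> (\<forall>v. H s *v v = 0 \<longrightarrow> v = 0)"
      by (metis invertible_left_inverse matrix_left_invertible_ker)
    then obtain v where v: "H s *v v = 0" "v \<noteq> 0" by blast
    have "0 = v \<bullet> (H s *v v)" using v by simp
    also have "\<dots> = (1 - s) * (v \<bullet> v) + s * (v \<bullet> (G *v v))" by (simp add: Hv inner_right_distrib)
    finally have e: "(1 - s) * (v \<bullet> v) + s * (v \<bullet> (G *v v)) = 0" by simp
    have "0 < v \<bullet> v" "0 < v \<bullet> (G *v v)" using v pos by auto
    then have "0 < (1 - s) * (v \<bullet> v) + s * (v \<bullet> (G *v v))"
      using s by (cases "s = 0") (auto intro!: add_nonneg_pos)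
    then show False using e by simp
  qed
  have cont: "continuous_on {0..1} (\<lambda>s. det (H s))"
    unfolding det_def H_def by (auto intro!: continuous_intros)
  have "H 0 = mat 1" "H 1 = G" by (simp_all add: H_def vec_eq_iff)
  moreover have "\<not> det (H 1) \<le> 0"
  proof
    assume "det (H 1) \<le> 0"
    then have "\<exists>x\<ge>0. x \<le> 1 \<and> det (H x) = 0"
      using IVT2'[of "\<lambda>s. det (H s)" 1 0 0] cont \<open>H 0 = mat 1\<close> by auto
    then show False using nz by blast
  qed
  ultimately show ?thesis by simp
qed

lemma linear_functional_vec:
  fixes L :: "real^'n \<Rightarrow> real"
  assumes "linear L" shows "L v = (\<chi> i. L (axis i 1)) \<bullet> v"
proof -
  have "L v = L (\<Sum>i\<in>UNIV. (v $ i) *\<^sub>R axis i 1)"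
    using basis_expansion[of v] by (simp add: scalar_mult_eq_scaleR)
  also have "\<dots> = (\<Sum>i\<in>UNIV. v $ i * L (axis i 1))"
    using assms by (simp add: linear_sum linear_scale)
  finally show ?thesis by (simp add: inner_vec_def mult.commute)
qed

lemma inner_matrix_vector_transpose:
  fixes A :: "real^'n^'m" shows "(A *v x) \<bullet> y = x \<bullet> (transpose A *v y)"
  by (metis dot_lmul_matrix inner_commute transpose_matrix_vector)

section \<open>Smooth functions of space and time\<close>

lemma Ck_on_imp_C1_on:
  assumes "Ck_on (Suc 0) W G" "open W" shows "C1_on W G"
  unfolding C1_on_def
proof (intro conjI ballI allI)
  fix x assume "x \<in> W"
  moreover have "G differentiable_on W" using assms(1) by simp
  ultimately show "G differentiable at x"
    using at_within_open[OF _ assms(2)] unfolding differentiable_on_def by fastforce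
next
  fix v show "continuous_on W (\<lambda>x. frechet_derivative G (at x) v)" using assms(1) by simp
qed

lemma smooth_onE:
  assumes "smooth_on S F" "x \<in> S"
  obtains W G where "open W" "x \<in> W" "\<forall>k. Ck_on k W G" "\<forall>y\<in>S \<inter> W. F y = G y"
proof -
  have "\<exists>W G. open W \<and> x \<in> W \<and> (\<forall>k. Ck_on k W G) \<and> (\<forall>y\<in>S \<inter> W. F y = G y)"
    using assms(1)[unfolded smooth_on_def] assms(2) by (rule bspec)
  then show ?thesis using that by (elim exE conjE)
qed

lemma smooth_onI:
  assumes "\<And>x. x \<in> S \<Longrightarrow> \<exists>W G. open W \<and> x \<in> W \<and> (\<forall>k. Ck_on k W G) \<and> (\<forall>y\<in>S \<inter> W. F y = G y)"
  shows "smooth_on S F"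
  using assms unfolding smooth_on_def by (rule ballI)

lemma smooth_on_imp_C1_on:
  assumes "smooth_on S F" "open S" shows "C1_on S F"
proof (rule C1_on_local)
  fix x assume "x \<in> S"
  from smooth_onE[OF assms(1) this] obtain W G
    where W: "open W" "x \<in> W" "\<forall>k. Ck_on k W G" "\<forall>y\<in>S \<inter> W. F y = G y" .
  have "C1_on W G" by (rule Ck_on_imp_C1_on[OF W(3)[rule_format] W(1)])
  then have "C1_on (W \<inter> S) G" by (rule C1_on_subset) auto
  then have "C1_on (W \<inter> S) F"
    by (rule C1_on_cong_open) (use W(1,4) assms(2) in auto)
  then show "\<exists>U. open U \<and> x \<in> U \<and> C1_on (U \<inter> S) F" using W(1,2) by blast
qed

lemma smooth_on_imp_continuous_on: assumes "smooth_on S F" shows "continuous_on S F"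
  unfolding continuous_on_eq_continuous_within
proof
  fix x assume x: "x \<in> S"
  from smooth_onE[OF assms this] obtain W G
    where W: "open W" "x \<in> W" "\<forall>k. Ck_on k W G" "\<forall>y\<in>S \<inter> W. F y = G y" .
  have "continuous_on W G" using W(3)[rule_format, of 0] by simp
  then have "isCont G x" using W(1,2) by (simp add: continuous_on_eq_continuous_at)
  then have "continuous (at x within S) G" by (rule continuous_at_imp_continuous_at_within)
  moreover have "\<forall>\<^sub>F y in at x within S. G y = F y"
    unfolding eventually_at_topological using W(1,2,4) by (metis IntI)
  moreover have "G x = F x" using W(2,4) x by simp
  ultimately show "continuous (at x within S) F"
    unfolding continuous_within using tendsto_cong[of G F "at x within S" "F x"] by simp
qed

text \<open>On \<open>V \<times> {a..b}\<close> smoothness refers to local extensions \<open>G\<close>. Because \<open>V\<close> is open, the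
spatial derivative of a slice is that of \<open>G\<close>, and because the interval is not a point, so is the
one-sided time derivative at its ends. Both are directional derivatives of a smooth function, so
smoothness on the product is inherited, and the lemma can be iterated.\<close>

lemma smooth_on_slice_derivatives:
  fixes F :: "'a::euclidean_space \<times> real \<Rightarrow> real"
  assumes F: "smooth_on (V \<times> {a..b}) F" and V: "open V" and "a < b"
  shows "smooth_on (V \<times> {a..b}) (\<lambda>z. frechet_derivative (\<lambda>y. F (y, snd z)) (at (fst z)) v)" (is ?A)
    and "x \<in> V \<Longrightarrow> t \<in> {a..b} \<Longrightarrow> (\<lambda>y. F (y, t)) differentiable (at x)" (is "_ \<Longrightarrow> _ \<Longrightarrow> ?B")
    and "smooth_on (V \<times> {a..b})
          (\<lambda>z. vector_derivative (\<lambda>s. F (fst z, s)) (at (snd z) within {a..b}))" (is ?C)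
    and "x \<in> V \<Longrightarrow> t \<in> {a..b} \<Longrightarrow> ((\<lambda>s. F (x, s)) has_vector_derivative
            vector_derivative (\<lambda>s. F (x, s)) (at t within {a..b})) (at t within {a..b})"
      (is "_ \<Longrightarrow> _ \<Longrightarrow> ?D")
proof -
  have D: "((\<lambda>y. F (y, t)) has_derivative (\<lambda>v. frechet_derivative G (at (x, t)) (v, 0))) (at x) \<and>
     ((\<lambda>s. F (x, s)) has_vector_derivative (frechet_derivative G (at (x, t)) (0, 1))) (at t within {a..b})"
    if W: "open W" "(x, t) \<in> W" "\<forall>k. Ck_on k W G" "\<forall>y\<in>(V \<times> {a..b}) \<inter> W. F y = G y"
      and x: "x \<in> V" "t \<in> {a..b}" for W G x t
  proof -
    have G: "(G has_derivative frechet_derivative G (at (x, t))) (at (x, t))"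
      by (rule C1_onD[OF Ck_on_imp_C1_on[OF W(3)[rule_format] W(1)] W(2)])
    have "((\<lambda>y. (y, t)) has_derivative (\<lambda>v. (v, 0))) (at x)"
      by (auto intro!: derivative_eq_intros)
    from has_derivative_compose[of "\<lambda>y. (y, t)", OF this, of G] G
    have "((\<lambda>y. G (y, t)) has_derivative (\<lambda>v. frechet_derivative G (at (x, t)) (v, 0))) (at x)"
      by simp
    moreover have "open ((\<lambda>y. (y, t)) -` W \<inter> V)"
      using W(1) V by (intro open_Int open_vimage continuous_intros)
    ultimately have 1: "((\<lambda>y. F (y, t)) has_derivative (\<lambda>v. frechet_derivative G (at (x, t)) (v, 0))) (at x)"
      by (rule has_derivative_transform_within_open) (use W(2,4) x in auto)
    interpret linear "frechet_derivative G (at (x, t))" using has_derivative_linear[OF G] .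
    have "((\<lambda>s. (x, s)) has_derivative (\<lambda>h. (0, h))) (at t)"
      by (auto intro!: derivative_eq_intros)
    from has_derivative_compose[of "\<lambda>s. (x, s)", OF this, of G] G
    have "((\<lambda>s. G (x, s)) has_derivative (\<lambda>h. frechet_derivative G (at (x, t)) (0, h))) (at t)"
      by simp
    moreover have "frechet_derivative G (at (x, t)) (0, h) = h *\<^sub>R frechet_derivative G (at (x, t)) (0, 1)" for h
      using scale[of h "(0, 1)"] by simp
    then have "(\<lambda>h. frechet_derivative G (at (x, t)) (0, h)) = (\<lambda>h. h *\<^sub>R frechet_derivative G (at (x, t)) (0, 1))"
      by (intro ext)
    ultimately have "((\<lambda>s. G (x, s)) has_vector_derivative (frechet_derivative G (at (x, t)) (0, 1))) (at t)"
      unfolding has_vector_derivative_def by (simp only:)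
    then have "((\<lambda>s. G (x, s)) has_vector_derivative (frechet_derivative G (at (x, t)) (0, 1))) (at t within {a..b})"
      by (rule has_vector_derivative_at_within)
    moreover have "open ((\<lambda>s. (x, s)) -` W)"
      by (intro open_vimage[OF W(1)] continuous_intros)
    then obtain e where e: "e > 0" "ball t e \<subseteq> (\<lambda>s. (x, s)) -` W"
      using W(2) by (metis open_contains_ball vimageI)
    ultimately have "((\<lambda>s. F (x, s)) has_vector_derivative (frechet_derivative G (at (x, t)) (0, 1))) (at t within {a..b})"
    proof (rule_tac has_vector_derivative_transform_within[where d=e])
      fix s assume "s \<in> {a..b}" "dist s t < e"
      then have "s \<in> ball t e" by (simp add: dist_commute)
      then have "(x, s) \<in> W" using e(2) by auto
      then show "G (x, s) = F (x, s)" using W(4) x \<open>s \<in> {a..b}\<close> by simp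
    qed (use x e in auto)
    with 1 show ?thesis by blast
  qed

  show ?B if "x \<in> V" "t \<in> {a..b}"
  proof -
    from that have "(x, t) \<in> V \<times> {a..b}" by simp
    from smooth_onE[OF F this] obtain W G where
      W: "open W" "(x, t) \<in> W" "\<forall>k. Ck_on k W G" "\<forall>y\<in>(V \<times> {a..b}) \<inter> W. F y = G y" .
    from D[OF this that] show ?thesis unfolding differentiable_def by blast
  qed
  show ?D if xt: "x \<in> V" "t \<in> {a..b}"
  proof -
    from xt have "(x, t) \<in> V \<times> {a..b}" by simp
    from smooth_onE[OF F this] obtain W G where
      W: "open W" "(x, t) \<in> W" "\<forall>k. Ck_on k W G" "\<forall>y\<in>(V \<times> {a..b}) \<inter> W. F y = G y" .
    from D[OF this xt] show ?thesis by (metis differentiableI_vector vector_derivative_works)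
  qed
  have dir: "\<forall>k. Ck_on k W (\<lambda>z. frechet_derivative G (at z) w)" if "\<forall>k. Ck_on k W G" for W w
    and G :: "'a \<times> real \<Rightarrow> real"
  proof
    fix k show "Ck_on k W (\<lambda>z. frechet_derivative G (at z) w)" using that[rule_format, of "Suc k"]
      by (simp only: Ck_on.simps)
  qed
  show ?A
  proof (rule smooth_onI)
    fix z assume "z \<in> V \<times> {a..b}"
    from smooth_onE[OF F this] obtain W G where
      W: "open W" "z \<in> W" "\<forall>k. Ck_on k W G" "\<forall>y\<in>(V \<times> {a..b}) \<inter> W. F y = G y" .
    have "frechet_derivative (\<lambda>y. F (y, snd q)) (at (fst q)) v = frechet_derivative G (at q) (v, 0)"
      if "q \<in> (V \<times> {a..b}) \<inter> W" for q
      using D[of W "fst q" "snd q" G] W(1,3,4) that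
        frechet_derivative_has_derivative[of "\<lambda>y. F (y, snd q)" _ "fst q"]
          by (auto simp: mem_Times_iff)
    with W(1,2) dir[OF W(3), of "(v, 0)"] show "\<exists>W G. open W \<and> z \<in> W \<and> (\<forall>k. Ck_on k W G) \<and>
      (\<forall>y\<in>(V \<times> {a..b}) \<inter> W. frechet_derivative (\<lambda>x. F (x, snd y)) (at (fst y)) v = G y)"
      by (intro exI[of _ W] exI[of _ "\<lambda>z. frechet_derivative G (at z) (v, 0)"] conjI ballI)
  qed
  show ?C
  proof (rule smooth_onI)
    fix z assume "z \<in> V \<times> {a..b}"
    from smooth_onE[OF F this] obtain W G where
      W: "open W" "z \<in> W" "\<forall>k. Ck_on k W G" "\<forall>y\<in>(V \<times> {a..b}) \<inter> W. F y = G y" .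
    have "vector_derivative (\<lambda>s. F (fst q, s)) (at (snd q) within {a..b}) = frechet_derivative G (at q) (0, 1)"
      if "q \<in> (V \<times> {a..b}) \<inter> W" for q
    proof (rule vector_derivative_within_cbox[OF \<open>a < b\<close>, unfolded cbox_interval])
      show "snd q \<in> {a..b}" using that by auto
      show "((\<lambda>s. F (fst q, s)) has_vector_derivative frechet_derivative G (at q) (0, 1)) (at (snd q) within {a..b})"
        using D[of W "fst q" "snd q" G] W(1,3,4) that by (auto simp: mem_Times_iff)
    qed
    with W(1,2) dir[OF W(3), of "(0, 1)"] show "\<exists>W G. open W \<and> z \<in> W \<and> (\<forall>k. Ck_on k W G) \<and>
      (\<forall>y\<in>(V \<times> {a..b}) \<inter> W. vector_derivative (\<lambda>s. F (fst y, s)) (at (snd y) within {a..b}) = G y)"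
      by (intro exI[of _ W] exI[of _ "\<lambda>z. frechet_derivative G (at z) (0, 1)"] conjI ballI)
  qed
qed

lemma smooth_on_slice_C1:
  fixes F :: "'a::euclidean_space \<times> real \<Rightarrow> real"
  assumes F: "smooth_on (V \<times> {a..b}) F" and V: "open V" and ab: "a < b" and t: "t \<in> {a..b}"
  shows "C1_on V (\<lambda>y. F (y, t))"
  unfolding C1_on_def
proof (intro conjI ballI allI)
  fix x assume "x \<in> V"
  then show "(\<lambda>y. F (y, t)) differentiable at x"
    by (rule smooth_on_slice_derivatives(2)[OF F V ab _ t])
next
  fix v
  have "continuous_on V (\<lambda>x. (x, t))" by (intro continuous_intros)
  moreover have "(\<lambda>x. (x, t)) ` V \<subseteq> V \<times> {a..b}" using t by auto
  ultimately show "continuous_on V (\<lambda>x. frechet_derivative (\<lambda>y. F (y, t)) (at x) v)"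
    using continuous_on_compose2[OF smooth_on_imp_continuous_on[OF smooth_on_slice_derivatives(1)[OF F V ab, of v]]]
    by fastforce
qed

section \<open>Integrals of derivatives of compactly supported functions\<close>

text \<open>The difference quotients of \<open>h\<close> in the direction \<open>v\<close> have integral zero, since Lebesgue
measure is translation invariant, and they converge boundedly, with support in a fixed ball, to
the derivative.\<close>

lemma integral_directional_derivative_eq_0:
  fixes h :: "'a::euclidean_space \<Rightarrow> real"
  assumes h: "\<And>x. (h has_derivative h' x) (at x)"
    and K: "compact K" "\<And>x. x \<notin> K \<Longrightarrow> h x = 0" "\<And>x. x \<notin> K \<Longrightarrow> h' x v = 0"
    and cont: "continuous_on UNIV (\<lambda>x. h' x v)"
  shows "(\<integral>x. h' x v \<partial>lborel) = 0"
proof -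
  have meas: "(\<lambda>x. h' x v) \<in> borel_measurable borel" using cont
    by (rule borel_measurable_continuous_onI)
  have conth: "continuous_on UNIV h"
    by (intro continuous_at_imp_continuous_on ballI has_derivative_continuous[OF h])
  then have meash: "h \<in> borel_measurable borel" by (rule borel_measurable_continuous_onI)
  obtain B where B: "\<And>x. x \<in> K \<Longrightarrow> norm (h' x v) \<le> B"
    using compact_imp_bounded[OF compact_continuous_image[OF continuous_on_subset[OF cont] K(1)]]
    unfolding bounded_iff by auto
  define C where "C = max B 0"
  have C: "norm (h' x v) \<le> C" for x using B[of x] K(3)[of x] by (cases "x \<in> K") (auto simp: C_def)
  have C0: "C \<ge> 0" by (simp add: C_def)
  \<comment> \<open>A ball that contains the supports of all the translates of \<open>h\<close> used below: the steps
    \<open>inverse (Suc n)\<close> are at most 1, so it suffices to enlarge the radius by \<open>norm v\<close>.\<close>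
  obtain R where R: "\<And>x. x \<in> K \<Longrightarrow> norm x \<le> R"
    using compact_imp_bounded[OF K(1)] unfolding bounded_iff by auto
  define K' where "K' = cball (0::'a) (R + norm v)"
  define q where "q n x = (h (x + inverse (real (Suc n)) *\<^sub>R v) - h x) * real (Suc n)" for n x
  have lim: "(\<lambda>n. q n x) \<longlonglongrightarrow> h' x v" for x
  proof -
    have "((\<lambda>t. h (x + t *\<^sub>R v)) has_derivative (\<lambda>t. h' (x + 0 *\<^sub>R v) (t *\<^sub>R v))) (at 0)"
      by (rule has_derivative_compose[OF _ h]) (auto intro!: derivative_eq_intros)
    moreover have "h' x (t *\<^sub>R v) = h' x v * t" for t
      using linear_scale[OF has_derivative_linear[OF h[of x]], of t v] by simp
    ultimately have "((\<lambda>t. h (x + t *\<^sub>R v)) has_real_derivative h' x v) (at 0)"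
      unfolding has_field_derivative_def by (simp add: mult_commute_abs)
    then have "((\<lambda>t. (h (x + t *\<^sub>R v) - h x) / t) \<longlongrightarrow> h' x v) (at 0)"
      unfolding has_field_derivative_iff by simp
    moreover have "filterlim (\<lambda>n. inverse (real (Suc n))) (at 0) sequentially"
      using LIMSEQ_inverse_real_of_nat by (auto simp: filterlim_at)
    ultimately have "((\<lambda>n. (h (x + inverse (real (Suc n)) *\<^sub>R v) - h x) / inverse (real (Suc n))) \<longlongrightarrow> h' x v) sequentially"
      by (rule filterlim_compose)
    then show ?thesis by (simp add: q_def divide_inverse)
  qed
  have bound: "norm (q n x) \<le> C * indicator K' x" for n x
  proof (cases "x \<in> K'")
    case True
    define e where "e = inverse (real (Suc n))"
    have e: "e > 0" by (simp add: e_def)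
    have "norm (h (x + e *\<^sub>R v) - h (x + 0 *\<^sub>R v)) \<le> C * norm (e - 0)"
    proof (rule differentiable_bound[where S="{0..e}" and f="\<lambda>t. h (x + t *\<^sub>R v)"
          and f'="\<lambda>t s. h' (x + t *\<^sub>R v) (s *\<^sub>R v)"])
      fix t
      show "((\<lambda>t. h (x + t *\<^sub>R v)) has_derivative (\<lambda>s. h' (x + t *\<^sub>R v) (s *\<^sub>R v))) (at t within {0..e})"
        by (rule has_derivative_compose[OF _ h]) (auto intro!: derivative_eq_intros)
      show "onorm (\<lambda>s. h' (x + t *\<^sub>R v) (s *\<^sub>R v)) \<le> C"
        using C[of "x + t *\<^sub>R v"] linear_scale[OF has_derivative_linear[OF h[of "x + t *\<^sub>R v"]]]
        by (intro onorm_bound C0) (auto simp: abs_mult mult.commute[of C] intro!: mult_left_mono)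
    qed (use e in auto)
    then have "\<bar>h (x + e *\<^sub>R v) - h x\<bar> \<le> C * e" using e by simp
    then have "\<bar>h (x + e *\<^sub>R v) - h x\<bar> * real (Suc n) \<le> C * e * real (Suc n)"
      by (rule mult_right_mono) simp
    also have "\<dots> = C" by (simp add: e_def)
    finally show ?thesis using True by (simp add: q_def e_def abs_mult)
  next
    case False
    then have "norm x > R + norm v" by (simp add: K'_def)
    moreover have "norm (inverse (real (Suc n)) *\<^sub>R v) \<le> 1 * norm v"
      unfolding norm_scaleR by (rule mult_right_mono) (auto simp: inverse_le_1_iff)
    moreover have "norm (x + inverse (real (Suc n)) *\<^sub>R v) \<ge> norm x - norm (inverse (real (Suc n)) *\<^sub>R v)"
      by (metis norm_diff_ineq)
    ultimately have "norm (x + inverse (real (Suc n)) *\<^sub>R v) > R" "norm x > R"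
      using norm_ge_zero[of v] by linarith+
    then have "x + inverse (real (Suc n)) *\<^sub>R v \<notin> K" "x \<notin> K" using R by (meson not_le)+
    then show ?thesis using False K(2) by (simp add: q_def)
  qed
  have int1: "integrable lborel (\<lambda>x. C * indicator K' x)"
    unfolding K'_def using emeasure_lborel_cball_finite
      by (intro integrable_mult_right) (simp add: integrable_indicator_iff)
  have mq: "q n \<in> borel_measurable lborel" for n
    unfolding q_def using meash by measurable
  have "(\<lambda>n. \<integral>x. q n x \<partial>lborel) \<longlonglongrightarrow> (\<integral>x. h' x v \<partial>lborel)"
    by (rule integral_dominated_convergence[where w="\<lambda>x. C * indicator K' x"])
      (use mq meas int1 lim bound in auto)
  \<comment> \<open>Each difference quotient integrates to zero by translation invariance.\<close>
  moreover have "(\<integral>x. q n x \<partial>lborel) = 0" for n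
  proof -
    have "integrable lborel (\<lambda>x. indicator K x *\<^sub>R h x)"
      by (rule borel_integrable_compact[OF K(1) continuous_on_subset[OF conth]]) simp
    moreover have "(\<lambda>x. indicator K x *\<^sub>R h x) = h"
      using K(2) by (auto simp: indicator_def fun_eq_iff)
    ultimately have ih: "integrable lborel h" by simp
    let ?t = "inverse (real (Suc n)) *\<^sub>R v"
    have "(\<integral>x. h (?t + x) \<partial>lborel) = integral\<^sup>L (distr lborel borel ((+) ?t)) h"
      by (rule integral_distr[symmetric]) (use meash in auto)
    then have e: "(\<integral>x. h (?t + x) \<partial>lborel) = (\<integral>x. h x \<partial>lborel)"
      using lborel_distr_plus[of ?t] by simp
    have "integrable (distr lborel borel ((+) ?t)) h" using lborel_distr_plus[of ?t] ih by simp
    then have "integrable lborel (\<lambda>x. h (?t + x))"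
      by (subst (asm) integrable_distr_eq) (use meash in auto)
    then have "(\<integral>x. (h (x + ?t) - h x) * real (Suc n) \<partial>lborel) = 0"
      using ih e by (simp add: add.commute)
    then show ?thesis by (simp add: q_def)
  qed
  ultimately have "(\<lambda>n::nat. 0::real) \<longlonglongrightarrow> (\<integral>x. h' x v \<partial>lborel)" by simp
  then show ?thesis by (rule LIMSEQ_unique[OF _ tendsto_const])
qed

lemma integral_partial_derivative_compact_support:
  fixes h :: "'a::euclidean_space \<Rightarrow> real"
  assumes h: "C1_on UNIV h" and K: "compact K" "\<And>x. x \<notin> K \<Longrightarrow> h x = 0"
  shows "integrable lborel (\<lambda>x. frechet_derivative h (at x) v)"
    and "(\<integral>x. frechet_derivative h (at x) v \<partial>lborel) = 0"
proof -
  have z: "frechet_derivative h (at x) v = 0" if "x \<notin> K" for x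
  proof -
    have "open (- K)" using K(1) compact_imp_closed by blast
    then have "frechet_derivative h (at x) = frechet_derivative (\<lambda>_. 0) (at x)"
      by (rule frechet_derivative_cong_open) (use that K in auto)
    then show ?thesis by simp
  qed
  have c: "continuous_on UNIV (\<lambda>x. frechet_derivative h (at x) v)"
    by (rule C1_on_continuous_deriv[OF h])
  have "integrable lborel (\<lambda>x. indicator K x *\<^sub>R frechet_derivative h (at x) v)"
    by (rule borel_integrable_compact[OF K(1) continuous_on_subset[OF c]]) simp
  moreover have "(\<lambda>x. indicator K x *\<^sub>R frechet_derivative h (at x) v) = (\<lambda>x. frechet_derivative h (at x) v)"
    using z by (auto simp: indicator_def fun_eq_iff)
  ultimately show "integrable lborel (\<lambda>x. frechet_derivative h (at x) v)" by simp
  show "(\<integral>x. frechet_derivative h (at x) v \<partial>lborel) = 0"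
    by (rule integral_directional_derivative_eq_0[OF C1_onD[OF h] K z c]) auto
qed

section \<open>Charts and bump functions\<close>

lemma compact_space_finite_cover:
  assumes "compact_space M" "\<And>p. p \<in> topspace M \<Longrightarrow> \<exists>U. openin M U \<and> p \<in> U \<and> P U"
  obtains \<U> where "finite \<U>" "\<And>U. U \<in> \<U> \<Longrightarrow> openin M U \<and> P U" "topspace M = \<Union>\<U>"
proof -
  have "\<forall>U\<in>{U. openin M U \<and> P U}. openin M U" by blast
  moreover have "topspace M \<subseteq> \<Union>{U. openin M U \<and> P U}" using assms(2) by blast
  ultimately obtain \<U> where f: "finite \<U>" "\<U> \<subseteq> {U. openin M U \<and> P U}" "topspace M \<subseteq> \<Union>\<U>"
    using assms(1)[unfolded compact_space_alt, rule_format, of "{U. openin M U \<and> P U}"] by blast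
  have s: "topspace M = \<Union>\<U>" using f openin_subset by blast
  show ?thesis by (rule that[OF f(1) _ s]) (use f(2) in blast)
qed

context smooth_manifold
begin

lemma chart_dom_subset: "c \<in> \<A> \<Longrightarrow> chart_dom c \<subseteq> topspace M"
  using chart_dom_open openin_subset by blast

lemma topspace_chart: "p \<in> topspace M \<Longrightarrow> \<exists>c\<in>\<A>. p \<in> chart_dom c"
  using charts_cover by blast

lemma chart_at: assumes "p \<in> topspace M" shows "chart_at \<A> p \<in> \<A>" "p \<in> chart_dom (chart_at \<A> p)"
  using someI_ex[of "\<lambda>c. c \<in> \<A> \<and> p \<in> chart_dom c"] topspace_chart[OF assms]
  unfolding chart_at_def by blast+

lemma topspace_chart_dom: "c \<in> \<A> \<Longrightarrow> topspace (subtopology M (chart_dom c)) = chart_dom c"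
  using chart_dom_subset[of c] by auto

lemma chart_map_in: "p \<in> chart_dom c \<Longrightarrow> chart_map c p \<in> chart_img c"
  by (simp add: chart_img_def)

lemma chart_map_inv: "x \<in> chart_img c \<Longrightarrow> chart_map c (chart_inv c x) = x"
  unfolding chart_img_def chart_inv_def by (rule f_inv_into_f)

lemma chart_inv_in: "x \<in> chart_img c \<Longrightarrow> chart_inv c x \<in> chart_dom c"
  unfolding chart_img_def chart_inv_def by (rule inv_into_into)

lemma chart_inj: "c \<in> \<A> \<Longrightarrow> inj_on (chart_map c) (chart_dom c)"
  using homeomorphic_imp_injective_map[OF chart_homeomorphic] topspace_chart_dom by metis

lemma chart_inv_map: "c \<in> \<A> \<Longrightarrow> p \<in> chart_dom c \<Longrightarrow> chart_inv c (chart_map c p) = p"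
  unfolding chart_inv_def by (rule inv_into_f_f[OF chart_inj])

lemma chart_inv_image: "c \<in> \<A> \<Longrightarrow> U \<subseteq> chart_dom c \<Longrightarrow> chart_inv c ` chart_map c ` U = U"
  by (force simp: chart_inv_map image_image)

lemma chart_map_image: "S \<subseteq> chart_img c \<Longrightarrow> chart_map c ` chart_inv c ` S = S"
  by (force simp: chart_map_inv image_image)

lemma chart_map_image_open:
  assumes "c \<in> \<A>" "openin M U" "U \<subseteq> chart_dom c" shows "open (chart_map c ` U)"
proof -
  have "openin (subtopology M (chart_dom c)) U"
    using assms chart_dom_open by (simp add: openin_open_subtopology)
  then have "openin (top_of_set (chart_img c)) (chart_map c ` U)"
    using homeomorphic_map_openness[OF chart_homeomorphic[OF assms(1)], of U] assms(3)
      topspace_chart_dom[OF assms(1)] by metis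
  then show ?thesis using chart_img_open[OF assms(1)] openin_open_eq by blast
qed

lemma chart_inv_image_open:
  assumes "c \<in> \<A>" "open S" "S \<subseteq> chart_img c" shows "openin M (chart_inv c ` S)"
proof -
  have sub: "chart_inv c ` S \<subseteq> chart_dom c" using assms chart_inv_in by blast
  have "openin (top_of_set (chart_img c)) (chart_map c ` chart_inv c ` S)"
    unfolding chart_map_image[OF assms(3)]
    using assms(2,3) openin_open_eq[OF chart_img_open[OF assms(1)]] by simp
  then have "openin (subtopology M (chart_dom c)) (chart_inv c ` S)"
    using homeomorphic_map_openness[OF chart_homeomorphic[OF assms(1)], of "chart_inv c ` S"] sub
      topspace_chart_dom[OF assms(1)] by metis
  then show ?thesis
    using openin_open_subtopology[OF chart_dom_open[OF assms(1)]] by blast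
qed

lemma chart_inv_image_compact:
  assumes "c \<in> \<A>" "compact S" "S \<subseteq> chart_img c" shows "compactin M (chart_inv c ` S)"
proof -
  have sub: "chart_inv c ` S \<subseteq> chart_dom c" using assms chart_inv_in by blast
  have "compactin (top_of_set (chart_img c)) (chart_map c ` chart_inv c ` S)"
    unfolding chart_map_image[OF assms(3)] using assms by (simp add: compactin_subtopology)
  then have "compactin (subtopology M (chart_dom c)) (chart_inv c ` S)"
    using homeomorphic_map_compactness[OF chart_homeomorphic[OF assms(1)], of "chart_inv c ` S"] sub
      topspace_chart_dom[OF assms(1)] by metis
  then show ?thesis by (simp add: compactin_subtopology)
qed

lemma chart_map_image_compact:
  assumes "c \<in> \<A>" "compactin M K" "K \<subseteq> chart_dom c" shows "compact (chart_map c ` K)"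
proof -
  have "compactin (subtopology M (chart_dom c)) K" using assms by (simp add: compactin_subtopology)
  then have "compactin (top_of_set (chart_img c)) (chart_map c ` K)"
    using homeomorphic_map_compactness[OF chart_homeomorphic[OF assms(1)], of K] assms(3)
      topspace_chart_dom[OF assms(1)] by metis
  then show ?thesis by (simp add: compactin_subtopology)
qed

lemma transition_C1:
  assumes "c \<in> \<A>" "d \<in> \<A>"
  shows "open (chart_map c ` (chart_dom c \<inter> chart_dom d))"
    and "C1_on (chart_map c ` (chart_dom c \<inter> chart_dom d)) (transition c d)"
proof -
  show o: "open (chart_map c ` (chart_dom c \<inter> chart_dom d))"
    by (rule chart_map_image_open[OF assms(1) openin_Int[OF chart_dom_open[OF assms(1)]
          chart_dom_open[OF assms(2)]]]) simp
  show "C1_on (chart_map c ` (chart_dom c \<inter> chart_dom d)) (transition c d)"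
    by (rule smooth_on_imp_C1_on[OF transition_smooth[OF assms] o])
qed

definition C1_fun :: "('a \<Rightarrow> real) \<Rightarrow> bool" where
  "C1_fun h \<longleftrightarrow> (\<forall>c\<in>\<A>. C1_on (chart_img c) (h \<circ> chart_inv c))"

lemma continuous_map_chartsI:
  assumes "\<And>c. c \<in> \<A> \<Longrightarrow> continuous_on (chart_img c) (h \<circ> chart_inv c)"
  shows "continuous_map M euclideanreal h"
  unfolding continuous_map_def
proof (intro conjI allI impI)
  fix S :: "real set" assume "openin euclideanreal S"
  then have S: "open S" by simp
  let ?V = "\<lambda>c. chart_img c \<inter> (h \<circ> chart_inv c) -` S"
  have V: "open (?V c)" if "c \<in> \<A>" for c
    using continuous_open_preimage[OF assms[OF that] chart_img_open[OF that] S] .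
  have "{p \<in> topspace M. h p \<in> S} = (\<Union>c\<in>\<A>. chart_inv c ` ?V c)"
  proof (intro equalityI subsetI)
    fix p assume p: "p \<in> {p \<in> topspace M. h p \<in> S}"
    then obtain c where c: "c \<in> \<A>" "p \<in> chart_dom c" using topspace_chart by blast
    then have "chart_map c p \<in> ?V c" using p by (simp add: chart_map_in chart_inv_map)
    then have "p \<in> chart_inv c ` ?V c" using chart_inv_map[OF c] by (metis imageI)
    then show "p \<in> (\<Union>c\<in>\<A>. chart_inv c ` ?V c)" using c by blast
  next
    fix p assume "p \<in> (\<Union>c\<in>\<A>. chart_inv c ` ?V c)"
    then show "p \<in> {p \<in> topspace M. h p \<in> S}"
      using chart_inv_in chart_dom_subset by fastforce
  qed
  moreover have "openin M (chart_inv c ` ?V c)" if "c \<in> \<A>" for c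
    by (rule chart_inv_image_open[OF that V[OF that]]) auto
  ultimately show "openin M {p \<in> topspace M. h p \<in> S}" by auto
qed simp

lemma C1_fun_continuous_map: "C1_fun h \<Longrightarrow> continuous_map M euclideanreal h"
  unfolding C1_fun_def by (rule continuous_map_chartsI) (use C1_on_continuous in blast)

lemma C1_fun_const: "C1_fun (\<lambda>p. k)" unfolding C1_fun_def by (auto simp: o_def)

lemma C1_fun_mult: "C1_fun h \<Longrightarrow> C1_fun k \<Longrightarrow> C1_fun (\<lambda>p. h p * k p)"
  unfolding C1_fun_def o_def by (auto intro: C1_on_mult)

lemma C1_fun_add: "C1_fun h \<Longrightarrow> C1_fun k \<Longrightarrow> C1_fun (\<lambda>p. h p + k p)"
  unfolding C1_fun_def o_def by (auto intro: C1_on_add)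

lemma C1_fun_sum: "(\<And>i. i \<in> I \<Longrightarrow> C1_fun (h i)) \<Longrightarrow> C1_fun (\<lambda>p. \<Sum>i\<in>I. h i p)"
  by (induction I rule: infinite_finite_induct) (auto intro: C1_fun_const C1_fun_add)

lemma C1_fun_divide:
  assumes "C1_fun h" "C1_fun k" "\<And>p. p \<in> topspace M \<Longrightarrow> k p \<noteq> 0"
  shows "C1_fun (\<lambda>p. h p / k p)"
  unfolding C1_fun_def o_def
proof
  fix c assume c: "c \<in> \<A>"
  have "chart_inv c x \<in> topspace M" if "x \<in> chart_img c" for x
    using chart_inv_in[OF that] chart_dom_subset[OF c] by blast
  then show "C1_on (chart_img c) (\<lambda>x. h (chart_inv c x) / k (chart_inv c x))"
    using assms c unfolding C1_fun_def o_def by (intro C1_on_divide) auto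
qed

text \<open>In the chart the bump is \<open>(max 0 (r\<^sup>2 - \<bar>x - x0\<bar>\<^sup>2))\<^sup>2\<close>. That its extension by zero is
\<open>C\<^sup>1\<close> in all other charts uses the Hausdorff property: its compact support is closed.\<close>

lemma bump_function:
  assumes c: "c \<in> \<A>" and U: "openin M U" "U \<subseteq> chart_dom c" and p0: "p0 \<in> U"
  obtains b K where "C1_fun b" "\<And>p. b p \<ge> 0" "b p0 > 0" "compactin M K" "K \<subseteq> U"
    "\<And>p. p \<in> topspace M \<Longrightarrow> p \<notin> K \<Longrightarrow> b p = 0"
proof -
  define x0 where "x0 = chart_map c p0"
  have S: "open (chart_map c ` U)" by (rule chart_map_image_open[OF c U])
  then obtain r where r: "r > 0" "cball x0 r \<subseteq> chart_map c ` U"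
    using p0 open_contains_cball unfolding x0_def by blast
  \<comment> \<open>A positive part squared is \<open>C\<^sup>1\<close>, and this suffices below: test functions are
    differentiated only once.\<close>
  define \<beta> where "\<beta> x = (max 0 (r\<^sup>2 - (x - x0) \<bullet> (x - x0)))\<^sup>2" for x :: "real^'n"
  have \<beta>C: "C1_on UNIV \<beta>"
    unfolding \<beta>_def
  proof (rule C1_on_max_0_squared, rule C1_onI)
    fix x show "((\<lambda>x. r\<^sup>2 - (x - x0) \<bullet> (x - x0)) has_derivative (\<lambda>v. - (2 * ((x - x0) \<bullet> v)))) (at x)"
      by (auto intro!: derivative_eq_intros simp: inner_commute)
  qed (intro continuous_intros)
  have \<beta>0: "\<beta> x = 0" if "x \<notin> cball x0 r" for x
  proof -
    have "r < norm (x - x0)" using that by (simp add: dist_norm norm_minus_commute)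
    then have "r\<^sup>2 < (norm (x - x0))\<^sup>2" using r by (intro power_strict_mono) auto
    then show ?thesis by (simp add: \<beta>_def power2_norm_eq_inner)
  qed
  define K where "K = chart_inv c ` cball x0 r"
  define b where "b p = (if p \<in> chart_dom c then \<beta> (chart_map c p) else 0)" for p
  have img: "chart_map c ` U \<subseteq> chart_img c" using U by (auto simp: chart_img_def)
  have K: "compactin M K" unfolding K_def
    by (rule chart_inv_image_compact[OF c]) (use r img in auto)
  have KU: "K \<subseteq> U" unfolding K_def using r(2) chart_inv_image[OF c U(2)] by blast
  have b0: "b p = 0" if "p \<notin> K" for p
  proof (cases "p \<in> chart_dom c")
    case True
    then have "chart_map c p \<notin> cball x0 r"
      using that chart_inv_map[OF c True] unfolding K_def by (metis imageI)
    then show ?thesis using \<beta>0 by (simp add: b_def)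
  qed (simp add: b_def)
  have "C1_fun b" unfolding C1_fun_def
  proof
    fix d assume d: "d \<in> \<A>"
    \<comment> \<open>The two open sets cover the image of \<open>d\<close>. On the first the bump is \<open>\<beta>\<close> after a transition
      map; on the second, which is open because compact sets are closed, it vanishes.\<close>
    let ?O = "chart_map d ` (chart_dom d \<inter> chart_dom c)"
    let ?N = "chart_map d ` (chart_dom d \<inter> (topspace M - K))"
    have 1: "C1_on ?O (b \<circ> chart_inv d)"
    proof (rule C1_on_cong_open)
      show "C1_on ?O (\<lambda>x. \<beta> (transition d c x))"
        by (rule C1_on_compose[OF transition_C1(2)[OF d c] \<beta>C]) simp
      show "open ?O" by (rule transition_C1(1)[OF d c])
      fix x assume "x \<in> ?O"
      then show "(b \<circ> chart_inv d) x = \<beta> (transition d c x)"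
        using chart_inv_map[OF d] by (auto simp: b_def transition_def)
    qed
    have oN: "open ?N"
    proof (rule chart_map_image_open[OF d])
      have "closedin M K" by (rule compactin_imp_closedin[OF hausdorff K])
      then show "openin M (chart_dom d \<inter> (topspace M - K))"
        using chart_dom_open[OF d] openin_diff openin_topspace by blast
    qed auto
    have 2: "C1_on ?N (b \<circ> chart_inv d)"
      by (rule C1_on_cong_open[OF C1_on_const[of _ 0] oN]) (use chart_inv_map[OF d] b0 in auto)
    have "chart_img d = ?O \<union> ?N"
      unfolding chart_img_def using chart_dom_subset[OF d] KU U(2) by blast
    then show "C1_on (chart_img d) (b \<circ> chart_inv d)"
      using C1_on_open_Un[OF 1 2 transition_C1(1)[OF d c] oN] by simp
  qed
  moreover have "b p \<ge> 0" for p by (simp add: b_def \<beta>_def)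
  moreover have "b p0 > 0" using p0 U(2) r(1) by (auto simp: b_def \<beta>_def x0_def)
  ultimately show ?thesis using that K KU b0 by blast
qed

end

section \<open>The weighted measure in a chart\<close>

locale weighted_manifold = closed_riemannian_manifold M \<A> g
  for M :: "'a topology" and \<A> :: "('a, 'n::finite) chart set" and g :: "('a, 'n) matrix_field" +
  fixes f :: "'a \<Rightarrow> real" and T :: "('a, 'n) matrix_field" and \<nu> :: "'a measure"
  assumes riemannian_measure: "is_riemannian_measure M \<A> g \<nu>"
    and potential_smooth: "smooth_function \<A> f"
    and tensor_spd: "smooth_spd_tensor11 \<A> g T"
begin

abbreviation "\<mu> \<equiv> weighted_measure \<nu> f"

lemma smooth_function_C1: assumes "smooth_function \<A> h" shows "C1_fun h"
  unfolding C1_fun_def using assms smooth_on_imp_C1_on chart_img_open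
  unfolding smooth_function_def by blast

lemma continuous_bounded:
  assumes "continuous_map M euclideanreal h"
  obtains B where "\<And>p. p \<in> topspace M \<Longrightarrow> \<bar>h p\<bar> \<le> B"
proof -
  have "compactin euclideanreal (h ` topspace M)"
    using image_compactin[OF _ assms] compact unfolding compact_space_def by blast
  then have "bounded (h ` topspace M)" by (simp add: compact_imp_bounded)
  then show ?thesis using that unfolding bounded_iff by auto
qed

lemma component_C1:
  assumes "smooth_components \<A> S" "c \<in> \<A>"
  shows "C1_on (chart_img c) (\<lambda>x. S c (chart_inv c x) $ i $ j)"
proof -
  have "smooth_on (chart_img c) (S c \<circ> chart_inv c)" using assms unfolding smooth_components_def
    by blast
  then have "C1_on (chart_img c) (S c \<circ> chart_inv c)"
    by (rule smooth_on_imp_C1_on[OF _ chart_img_open[OF assms(2)]])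
  moreover have "bounded_linear (\<lambda>A::real^'n^'n. A $ i $ j)"
    by (intro bounded_linear_compose[OF bounded_linear_vec_nth bounded_linear_vec_nth])
  ultimately show ?thesis using C1_on_bounded_linear[of "\<lambda>A. A $ i $ j"] by (auto simp: o_def)
qed

lemma metric_det_pos: "c \<in> \<A> \<Longrightarrow> p \<in> chart_dom c \<Longrightarrow> 0 < det (g c p)"
  by (rule det_pos_of_positive_definite) (rule metric_positive)

definition rho :: "('a, 'n) chart \<Rightarrow> real^'n \<Rightarrow> real" where
  "rho c x = volume_density g c (chart_inv c x)"

text \<open>The density of \<open>\<mu>\<close> with respect to Lebesgue measure in the chart.\<close>

definition dens :: "('a, 'n) chart \<Rightarrow> real^'n \<Rightarrow> real" where
  "dens c x = rho c x * exp (- f (chart_inv c x))"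

lemma rho_pos: "c \<in> \<A> \<Longrightarrow> x \<in> chart_img c \<Longrightarrow> 0 < rho c x"
  unfolding rho_def volume_density_def using metric_det_pos[OF _ chart_inv_in] by simp

lemma rho_C1: "c \<in> \<A> \<Longrightarrow> C1_on (chart_img c) (rho c)"
  unfolding rho_def volume_density_def
  by (intro C1_on_sqrt C1_on_det component_C1 metric_smooth metric_det_pos chart_inv_in)

lemma dens_pos: "c \<in> \<A> \<Longrightarrow> x \<in> chart_img c \<Longrightarrow> 0 < dens c x"
  unfolding dens_def using rho_pos by simp

lemma dens_C1: assumes "c \<in> \<A>" shows "C1_on (chart_img c) (dens c)"
proof -
  have "C1_on (chart_img c) (\<lambda>x. (-1) * f (chart_inv c x))"
    using smooth_function_C1[OF potential_smooth] assms unfolding C1_fun_def o_def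
    by (intro C1_on_mult C1_on_const) auto
  then show ?thesis unfolding dens_def
    by (intro C1_on_mult rho_C1 C1_on_exp assms) simp
qed

lemma space_nu: "space \<nu> = topspace M"
  and sets_nu: "sets \<nu> = sigma_sets (topspace M) {U. openin M U}"
  and emeasure_nu: "\<And>c B. c \<in> \<A> \<Longrightarrow> B \<in> sets \<nu> \<Longrightarrow> B \<subseteq> chart_dom c \<Longrightarrow> emeasure \<nu> B =
          (\<integral>\<^sup>+x\<in>chart_map c ` B. ennreal (rho c x) \<partial>lborel)"
  using riemannian_measure unfolding is_riemannian_measure_def rho_def by blast+

lemma openin_sets: "openin M U \<Longrightarrow> U \<in> sets \<nu>"
  unfolding sets_nu by (rule sigma_sets.Basic) simp

lemma continuous_measurable:
  assumes "continuous_map M euclideanreal h" shows "h \<in> borel_measurable \<nu>"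
proof (rule borel_measurableI)
  fix S :: "real set" assume "open S"
  then have "openin M {p \<in> topspace M. h p \<in> S}"
    using assms unfolding continuous_map_def by simp
  moreover have "{p \<in> topspace M. h p \<in> S} = h -` S \<inter> space \<nu>" using space_nu by auto
  ultimately show "h -` S \<inter> space \<nu> \<in> sets \<nu>" using openin_sets by metis
qed

lemma emeasure_nu_finite: "emeasure \<nu> (topspace M) < \<infinity>"
proof -
  have loc: "\<exists>U. openin M U \<and> p \<in> U \<and> emeasure \<nu> U < \<infinity>" if p: "p \<in> topspace M" for p
  proof -
    obtain c where c: "c \<in> \<A>" "p \<in> chart_dom c" using topspace_chart[OF p] by blast
    let ?x = "chart_map c p"
    obtain r where r: "r > 0" "cball ?x r \<subseteq> chart_img c"
      using chart_img_open[OF c(1)] chart_map_in[OF c(2)] open_contains_cball by blast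
    have br: "ball ?x r \<subseteq> chart_img c" using r ball_subset_cball by blast
    let ?U = "chart_inv c ` ball ?x r"
    have oU: "openin M ?U" by (rule chart_inv_image_open[OF c(1) open_ball br])
    have "?U \<subseteq> chart_dom c" using br chart_inv_in by blast
    then have "emeasure \<nu> ?U = (\<integral>\<^sup>+x\<in>ball ?x r. ennreal (rho c x) \<partial>lborel)"
      using emeasure_nu[OF c(1) openin_sets[OF oU]] chart_map_image[OF br] by simp
    obtain B where B: "\<And>x. x \<in> cball ?x r \<Longrightarrow> norm (rho c x) \<le> B"
      using compact_imp_bounded[OF compact_continuous_image[OF continuous_on_subset[OF
        C1_on_continuous[OF rho_C1[OF c(1)]] r(2)] compact_cball]] unfolding bounded_iff
      by (metis imageI)
    have "ennreal (rho c x) * indicator (ball ?x r) x \<le> ennreal B * indicator (ball ?x r) x" for x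
      using B[of x] by (cases "x \<in> ball ?x r") (auto intro: ennreal_leI)
    then have "(\<integral>\<^sup>+x\<in>ball ?x r. ennreal (rho c x) \<partial>lborel) \<le> (\<integral>\<^sup>+x. ennreal B * indicator (ball ?x r) x \<partial>lborel)"
      by (intro nn_integral_mono)
    also have "\<dots> = ennreal B * emeasure lborel (ball ?x r)"
      by (intro nn_integral_cmult_indicator) simp
    also have "\<dots> < \<infinity>" using emeasure_lborel_ball_finite[of ?x r]
      by (simp add: ennreal_mult_less_top)
    finally have "emeasure \<nu> ?U < \<infinity>" using \<open>emeasure \<nu> ?U = _\<close> by simp
    moreover have "p \<in> ?U" using chart_inv_map[OF c] r(1) by (metis centre_in_ball imageI)
    ultimately show ?thesis using oU by blast
  qed
  obtain \<U> where \<U>: "finite \<U>" "\<And>U. U \<in> \<U> \<Longrightarrow> openin M U \<and> emeasure \<nu> U < \<infinity>" "topspace M = \<Union>\<U>"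
    using compact_space_finite_cover[where P="\<lambda>U. emeasure \<nu> U < \<infinity>", OF compact loc] by blast
  have "emeasure \<nu> (\<Union>U\<in>\<U>. U) \<le> (\<Sum>U\<in>\<U>. emeasure \<nu> U)"
    by (rule emeasure_subadditive_finite[OF \<U>(1)]) (use \<U>(2) openin_sets in auto)
  also have "\<dots> < \<infinity>" using \<U>(1,2) by (simp add: ennreal_sum_less_top)
  finally show ?thesis using \<U>(3) by simp
qed

lemma potential_continuous: "continuous_map M euclideanreal (\<lambda>p. exp (- f p))"
proof -
  have "continuous_map M euclideanreal f"
    by (rule C1_fun_continuous_map[OF smooth_function_C1[OF potential_smooth]])
  moreover have "continuous_map euclideanreal euclideanreal (\<lambda>x::real. exp (- x))"
    by (auto intro!: continuous_intros)
  ultimately show ?thesis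
    using continuous_map_compose[of M euclideanreal f euclideanreal "\<lambda>x. exp (- x)"]
    by (simp only: o_def)
qed

lemma weight_measurable [measurable]: "(\<lambda>p. exp (- f p)) \<in> borel_measurable \<nu>"
  by (rule continuous_measurable[OF potential_continuous])

lemma sets_mu: "sets \<mu> = sets \<nu>" and space_mu: "space \<mu> = topspace M"
  by (simp_all add: weighted_measure_def space_nu)

lemma continuous_measurable_mu:
  "continuous_map M euclideanreal h \<Longrightarrow> h \<in> borel_measurable \<mu>"
  using continuous_measurable measurable_cong_sets[OF sets_mu refl] by blast

lemma finite_measure_mu: "finite_measure \<mu>"
proof -
  obtain B where B: "\<And>p. p \<in> topspace M \<Longrightarrow> \<bar>exp (- f p)\<bar> \<le> B"
    using continuous_bounded[OF potential_continuous] by blast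
  have "emeasure \<mu> (space \<nu>) = (\<integral>\<^sup>+p. ennreal (exp (- f p)) * indicator (space \<nu>) p \<partial>\<nu>)"
    unfolding weighted_measure_def by (intro emeasure_density) auto
  also have "\<dots> \<le> (\<integral>\<^sup>+p. ennreal B \<partial>\<nu>)"
    using B by (intro nn_integral_mono) (auto simp: space_nu intro!: ennreal_leI)
  also have "\<dots> < \<infinity>"
    using emeasure_nu_finite by (simp add: space_nu ennreal_mult_less_top)
  finally show ?thesis by (intro finite_measureI) (simp add: space_mu space_nu)
qed

lemma continuous_integrable:
  assumes "continuous_map M euclideanreal h" shows "integrable \<mu> h"
proof -
  obtain B where B: "\<And>p. p \<in> topspace M \<Longrightarrow> \<bar>h p\<bar> \<le> B"
    using continuous_bounded[OF assms] by blast
  have "AE p in \<mu>. norm (h p) \<le> B" using B by (intro AE_I2) (simp add: space_mu)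
  then show ?thesis
    using finite_measure.integrable_const_bound[OF finite_measure_mu] continuous_measurable_mu[OF assms]
    by blast
qed

text \<open>Restricted to the chart domain, \<open>\<nu>\<close> is the image of the measure with density \<open>rho c\<close> on
the chart image; this is checked on measurable sets, where it is the defining property of the
Riemannian measure.\<close>

lemma integral_in_chart:
  assumes c: "c \<in> \<A>" and h: "h \<in> borel_measurable \<nu>"
    and h0: "\<And>p. p \<in> topspace M \<Longrightarrow> p \<notin> chart_dom c \<Longrightarrow> h p = 0"
  shows "(\<integral>p. h p \<partial>\<mu>) = (\<integral>x. indicator (chart_img c) x * dens c x * h (chart_inv c x) \<partial>lborel)"
proof (cases "topspace M = {}")
  case True
  then have "chart_dom c = {}" "space \<mu> = {}" using chart_dom_subset[OF c] space_mu by auto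
  then show ?thesis by (simp add: chart_img_def Bochner_Integration.integral_empty)
next
  case False
  then obtain p0 where p0: "p0 \<in> topspace M" by blast
  let ?V = "chart_img c"
  have oV: "?V \<in> sets borel" using chart_img_open[OF c] by simp
  \<comment> \<open>The inverse chart, made into a total map by sending the complement of the chart image,
    which carries no mass, to an arbitrary point.\<close>
  define e where "e x = (if x \<in> ?V then chart_inv c x else p0)" for x
  have e_in: "e x \<in> topspace M" for x
    using p0 chart_inv_in[of x c] chart_dom_subset[OF c] by (auto simp: e_def)
  have dom_sets: "chart_dom c \<in> sets \<nu>" by (rule openin_sets[OF chart_dom_open[OF c]])
  have e_meas [measurable]: "e \<in> lborel \<rightarrow>\<^sub>M \<nu>"
  proof (rule measurable_sigma_sets[OF sets_nu])
    show "{U. openin M U} \<subseteq> Pow (topspace M)" using openin_subset by auto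
    show "e \<in> space lborel \<rightarrow> topspace M" using e_in by auto
    fix U assume "U \<in> {U. openin M U}"
    then have "openin M (U \<inter> chart_dom c)" using chart_dom_open[OF c] by auto
    then have "open (chart_map c ` (U \<inter> chart_dom c))" by (rule chart_map_image_open[OF c]) auto
    moreover have "e -` U = chart_map c ` (U \<inter> chart_dom c) \<union> (if p0 \<in> U then - ?V else {})"
    proof (intro equalityI subsetI)
      fix x assume "x \<in> e -` U"
      then show "x \<in> chart_map c ` (U \<inter> chart_dom c) \<union> (if p0 \<in> U then - ?V else {})"
        using chart_map_inv[of x c] chart_inv_in[of x c]
        by (cases "x \<in> ?V") (auto simp: e_def intro: rev_image_eqI)
    next
      fix x assume "x \<in> chart_map c ` (U \<inter> chart_dom c) \<union> (if p0 \<in> U then - ?V else {})"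
      then show "x \<in> e -` U"
        using chart_inv_map[OF c] chart_map_in[of _ c] by (auto simp: e_def split: if_splits)
    qed
    ultimately show "e -` U \<inter> space lborel \<in> sets lborel" using oV by auto
  qed
  have rho_meas [measurable]: "(\<lambda>x. indicator ?V x * rho c x) \<in> borel_measurable borel"
    using borel_measurable_continuous_on_indicator[OF oV C1_on_continuous[OF rho_C1[OF c]]] by simp
  have rho_nn: "0 \<le> indicator ?V x * rho c x" for x
    using rho_pos[OF c, of x] by (auto simp: indicator_def)
  have eq: "density \<nu> (\<lambda>p. ennreal (indicator (chart_dom c) p)) =
      distr (density lborel (\<lambda>x. ennreal (indicator ?V x * rho c x))) \<nu> e"
  proof (rule measure_eqI)
    fix A assume "A \<in> sets (density \<nu> (\<lambda>p. ennreal (indicator (chart_dom c) p)))"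
    then have A: "A \<in> sets \<nu>" by simp
    have "emeasure (density \<nu> (\<lambda>p. ennreal (indicator (chart_dom c) p))) A = emeasure \<nu> (chart_dom c \<inter> A)"
      using emeasure_restricted[OF dom_sets A] by (simp add: ennreal_indicator)
    also have "\<dots> = (\<integral>\<^sup>+x\<in>chart_map c ` (chart_dom c \<inter> A). ennreal (rho c x) \<partial>lborel)"
      by (rule emeasure_nu[OF c]) (use dom_sets A in auto)
    also have "\<dots> = (\<integral>\<^sup>+x. ennreal (indicator ?V x * rho c x) * indicator (e -` A) x \<partial>lborel)"
    proof (intro nn_integral_cong)
      fix x
      have "x \<in> chart_map c ` (chart_dom c \<inter> A) \<longleftrightarrow> x \<in> ?V \<and> e x \<in> A"
        using chart_inv_map[OF c] chart_map_in[of _ c] chart_map_inv[of x c] chart_inv_in[of x c]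
        by (auto simp: e_def intro: rev_image_eqI)
      then show "ennreal (rho c x) * indicator (chart_map c ` (chart_dom c \<inter> A)) x =
          ennreal (indicator ?V x * rho c x) * indicator (e -` A) x"
        by (auto simp: indicator_def)
    qed
    also have "\<dots> = emeasure (density lborel (\<lambda>x. ennreal (indicator ?V x * rho c x))) (e -` A \<inter> space lborel)"
      using measurable_sets[OF e_meas A] by (subst emeasure_density) auto
    also have "\<dots> = emeasure (distr (density lborel (\<lambda>x. ennreal (indicator ?V x * rho c x))) \<nu> e) A"
      using A by (subst emeasure_distr) auto
    finally show "emeasure (density \<nu> (\<lambda>p. ennreal (indicator (chart_dom c) p))) A =
      emeasure (distr (density lborel (\<lambda>x. ennreal (indicator ?V x * rho c x))) \<nu> e) A" .
  qed simp
  define k where "k p = exp (- f p) * h p" for p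
  have k [measurable]: "k \<in> borel_measurable \<nu>" unfolding k_def using h by measurable
  have "(\<integral>p. h p \<partial>\<mu>) = (\<integral>p. k p \<partial>\<nu>)"
    unfolding weighted_measure_def k_def using h by (subst integral_density) auto
  also have "\<dots> = (\<integral>p. indicator (chart_dom c) p *\<^sub>R k p \<partial>\<nu>)"
    by (intro Bochner_Integration.integral_cong) (auto simp: indicator_def k_def h0 space_nu)
  also have "\<dots> = (\<integral>p. k p \<partial>density \<nu> (\<lambda>p. ennreal (indicator (chart_dom c) p)))"
    using dom_sets by (subst integral_density) auto
  also have "\<dots> = (\<integral>x. k (e x) \<partial>density lborel (\<lambda>x. ennreal (indicator ?V x * rho c x)))"
    unfolding eq by (subst integral_distr) auto
  also have "\<dots> = (\<integral>x. (indicator ?V x * rho c x) *\<^sub>R k (e x) \<partial>lborel)"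
    by (subst integral_density) (use rho_nn in auto)
  also have "\<dots> = (\<integral>x. indicator ?V x * dens c x * h (chart_inv c x) \<partial>lborel)"
    by (intro Bochner_Integration.integral_cong) (auto simp: indicator_def k_def e_def dens_def)
  finally show ?thesis .
qed

text \<open>Nonempty open sets have positive measure, as their chart images have positive Lebesgue
measure and the density is positive.\<close>

lemma integral_pos:
  assumes h: "continuous_map M euclideanreal h" "\<And>p. p \<in> topspace M \<Longrightarrow> 0 \<le> h p"
    and p: "p \<in> topspace M" "0 < h p"
  shows "0 < (\<integral>p. h p \<partial>\<mu>)"
proof (rule ccontr)
  assume "\<not> 0 < (\<integral>p. h p \<partial>\<mu>)"
  moreover have "0 \<le> (\<integral>p. h p \<partial>\<mu>)" using h(2)
    by (intro integral_nonneg_AE AE_I2) (simp add: space_mu)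
  ultimately have "(\<integral>p. h p \<partial>\<mu>) = 0" by simp
  moreover have "AE p in \<mu>. 0 \<le> h p" using h(2) by (intro AE_I2) (simp add: space_mu)
  ultimately have "AE p in \<mu>. h p = 0"
    using integral_nonneg_eq_0_iff_AE[OF continuous_integrable[OF h(1)]] by blast
  then have AE: "AE p in \<nu>. h p = 0" unfolding weighted_measure_def by (subst (asm) AE_density) auto
  obtain c where c: "c \<in> \<A>" "p \<in> chart_dom c" using topspace_chart[OF p(1)] by blast
  let ?U = "{q \<in> topspace M. h q \<in> {0<..}} \<inter> chart_dom c"
  have "openin M {q \<in> topspace M. h q \<in> {0<..}}"
    using h(1) open_greaterThan unfolding continuous_map_def by (metis open_openin)
  then have oU: "openin M ?U" using chart_dom_open[OF c(1)] by (rule openin_Int)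
  have "AE q in \<nu>. \<not> q \<in> ?U" using AE by (rule AE_mp) (auto intro: AE_I2)
  then have "emeasure \<nu> {q \<in> space \<nu>. q \<in> ?U} = 0" by (rule emeasure_eq_0_AE)
  moreover have "{q \<in> space \<nu>. q \<in> ?U} = ?U" by (auto simp: space_nu)
  ultimately have "emeasure \<nu> ?U = 0" by simp
  then have z: "(\<integral>\<^sup>+x\<in>chart_map c ` ?U. ennreal (rho c x) \<partial>lborel) = 0"
    using emeasure_nu[OF c(1) openin_sets[OF oU]] by simp
  let ?W = "chart_map c ` ?U"
  have oW: "open ?W" by (rule chart_map_image_open[OF c(1) oU]) auto
  have WV: "?W \<subseteq> chart_img c" by (auto simp: chart_map_in)
  have "(\<lambda>x. indicator ?W x *\<^sub>R rho c x) \<in> borel_measurable borel"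
    using oW
      by (intro borel_measurable_continuous_on_indicator continuous_on_subset[OF C1_on_continuous[OF rho_C1[OF c(1)]] WV]) auto
  then have "(\<lambda>x. ennreal (indicator ?W x *\<^sub>R rho c x)) \<in> borel_measurable borel" by measurable
  moreover have "ennreal (indicator ?W x *\<^sub>R rho c x) = ennreal (rho c x) * indicator ?W x" for x
    by (simp add: indicator_def)
  ultimately have "AE x in lborel. ennreal (rho c x) * indicator ?W x = 0"
    using z by (subst nn_integral_0_iff_AE[symmetric]) auto
  then have "AE x in lborel. x \<notin> ?W"
  proof (rule AE_mp, intro AE_I2 impI)
    fix x assume "ennreal (rho c x) * indicator ?W x = 0"
    moreover have "rho c x > 0" if "x \<in> ?W" using rho_pos[OF c(1)] WV that by blast
    ultimately show "x \<notin> ?W" by (cases "x \<in> ?W") (auto simp: ennreal_eq_0_iff)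
  qed
  then have "?W \<in> null_sets lborel" using oW AE_iff_null_sets[of ?W lborel] by auto
  then have "negligible ?W" using negligible_iff_null_sets null_sets_completionI by blast
  moreover have "p \<in> ?U" using p c by auto
  ultimately show False using open_not_negligible[OF oW] by blast
qed

section \<open>The operator in coordinates\<close>

definition dcoord :: "('a, 'n) chart \<Rightarrow> ('a \<Rightarrow> real) \<Rightarrow> real^'n \<Rightarrow> real^'n" where
  "dcoord c h x = (\<chi> i. frechet_derivative (h \<circ> chart_inv c) (at x) (axis i 1))"

text \<open>The matrix \<open>T g\<^sup>-\<^sup>1\<close>, which maps the partial derivatives of \<open>w\<close> to the components of
\<open>T(\<nabla>w)\<close>.\<close>

definition coef :: "('a, 'n) chart \<Rightarrow> real^'n \<Rightarrow> real^'n^'n" where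
  "coef c x = T c (chart_inv c x) ** matrix_inv (g c (chart_inv c x))"

text \<open>The components of \<open>T(\<nabla>w)\<close> times the weighted volume density; the operator is the Euclidean
divergence of this vector field, divided by the density.\<close>

definition flux :: "('a, 'n) chart \<Rightarrow> ('a \<Rightarrow> real) \<Rightarrow> real^'n \<Rightarrow> real^'n" where
  "flux c w x = dens c x *\<^sub>R (coef c x *v dcoord c w x)"

definition chart_operator :: "('a, 'n) chart \<Rightarrow> ('a \<Rightarrow> real) \<Rightarrow> real^'n \<Rightarrow> real" where
  "chart_operator c w x =
    (\<Sum>i\<in>UNIV. frechet_derivative (\<lambda>y. flux c w y $ i) (at x) (axis i 1)) / dens c x"

abbreviation pairing :: "('a \<Rightarrow> real) \<Rightarrow> ('a \<Rightarrow> real) \<Rightarrow> 'a \<Rightarrow> real" where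
  "pairing w v \<equiv> tensor_form \<A> g T (gradient g w) (gradient g v)"

abbreviation L :: "('a \<Rightarrow> real) \<Rightarrow> 'a \<Rightarrow> real" where
  "L w \<equiv> weighted_operator \<A> g f T w"

definition C2_fun :: "('a \<Rightarrow> real) \<Rightarrow> bool" where
  "C2_fun h \<longleftrightarrow> C1_fun h \<and>
    (\<forall>c\<in>\<A>. \<forall>v. C1_on (chart_img c) (\<lambda>x. frechet_derivative (h \<circ> chart_inv c) (at x) v))"

lemma C2_fun_C1: "C2_fun h \<Longrightarrow> C1_fun h" by (simp add: C2_fun_def)

lemma dcoord_deriv:
  assumes "C1_fun h" "c \<in> \<A>" "x \<in> chart_img c"
  shows "frechet_derivative (h \<circ> chart_inv c) (at x) v = dcoord c h x \<bullet> v"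
proof -
  have "C1_on (chart_img c) (h \<circ> chart_inv c)" using assms(1,2) unfolding C1_fun_def by blast
  from C1_onD[OF this assms(3)] show ?thesis
    unfolding dcoord_def using linear_functional_vec[OF has_derivative_linear] by blast
qed

lemma dcoord_cong:
  assumes "c \<in> \<A>" "x \<in> chart_img c" "openin M U" "chart_inv c x \<in> U" "\<And>p. p \<in> U \<Longrightarrow> h p = k p"
  shows "dcoord c h x = dcoord c k x"
proof -
  let ?V = "chart_map c ` (U \<inter> chart_dom c)"
  have "open ?V"
    by (rule chart_map_image_open[OF assms(1) openin_Int[OF assms(3) chart_dom_open[OF assms(1)]]]) simp
  moreover have "x \<in> ?V" using chart_map_inv[OF assms(2)] chart_inv_in[OF assms(2)] assms(4)
    by (metis IntI imageI)
  moreover have "(h \<circ> chart_inv c) y = (k \<circ> chart_inv c) y" if "y \<in> ?V" for y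
    using that assms(5) chart_inv_map[OF assms(1)] by auto
  ultimately have "frechet_derivative (h \<circ> chart_inv c) (at x) = frechet_derivative (k \<circ> chart_inv c) (at x)"
    by (rule frechet_derivative_cong_open)
  then show ?thesis unfolding dcoord_def by simp
qed

lemma dcoord_sum:
  assumes "\<And>i. i \<in> I \<Longrightarrow> C1_fun (h i)" "c \<in> \<A>" "x \<in> chart_img c"
  shows "dcoord c (\<lambda>p. \<Sum>i\<in>I. h i p) x = (\<Sum>i\<in>I. dcoord c (h i) x)"
proof -
  have "((\<lambda>y. \<Sum>i\<in>I. h i (chart_inv c y)) has_derivative
      (\<lambda>v. \<Sum>i\<in>I. frechet_derivative (h i \<circ> chart_inv c) (at x) v)) (at x)"
  proof (rule has_derivative_sum)
    fix i assume "i \<in> I"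
    then have "C1_on (chart_img c) (h i \<circ> chart_inv c)" using assms(1,2) unfolding C1_fun_def
      by blast
    from C1_onD[OF this assms(3)]
    show "((\<lambda>y. h i (chart_inv c y)) has_derivative frechet_derivative (h i \<circ> chart_inv c) (at x)) (at x)"
      by (simp add: o_def)
  qed
  then show ?thesis unfolding dcoord_def
    by (simp add: o_def frechet_derivative_has_derivative vec_eq_iff)
qed

lemma dcoord_transition:
  assumes h: "C1_fun h" and c: "c \<in> \<A>" "p \<in> chart_dom c" and d: "d \<in> \<A>" "p \<in> chart_dom d"
  shows "dcoord c h (chart_map c p) = transpose (transition_jacobian c d p) *v dcoord d h (chart_map d p)"
proof -
  let ?x = "chart_map c p" and ?y = "chart_map d p" and ?J = "transition_jacobian c d p"
  let ?O = "chart_map c ` (chart_dom c \<inter> chart_dom d)"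
  have xO: "?x \<in> ?O" using c d by blast
  have t: "transition c d ?x = ?y" by (simp add: transition_def chart_inv_map[OF c])
  have "transition c d differentiable (at ?x)"
    using transition_C1(2)[OF c(1) d(1)] xO unfolding C1_on_def by blast
  then have J: "(transition c d has_derivative (\<lambda>v. ?J *v v)) (at ?x)"
    unfolding jacobian_works transition_jacobian_def .
  have hd: "C1_on (chart_img d) (h \<circ> chart_inv d)" using h d(1) unfolding C1_fun_def by blast
  have "((h \<circ> chart_inv d) has_derivative frechet_derivative (h \<circ> chart_inv d) (at ?y)) (at (transition c d ?x))"
    unfolding t by (rule C1_onD[OF hd chart_map_in[OF d(2)]])
  from has_derivative_compose[OF J this]
  have "((\<lambda>x. (h \<circ> chart_inv d) (transition c d x)) has_derivative
      (\<lambda>v. frechet_derivative (h \<circ> chart_inv d) (at ?y) (?J *v v))) (at ?x)" .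
  then have "((h \<circ> chart_inv c) has_derivative
      (\<lambda>v. frechet_derivative (h \<circ> chart_inv d) (at ?y) (?J *v v))) (at ?x)"
    by (rule has_derivative_transform_within_open[OF _ transition_C1(1)[OF c(1) d(1)] xO])
      (use chart_inv_map[OF c(1)] chart_inv_map[OF d(1)] in \<open>auto simp: transition_def\<close>)
  then have "frechet_derivative (h \<circ> chart_inv c) (at ?x) v = dcoord d h ?y \<bullet> (?J *v v)" for v
    using dcoord_deriv[OF h d(1) chart_map_in[OF d(2)]]
      by (simp add: frechet_derivative_has_derivative)
  then have "dcoord c h ?x \<bullet> v = (transpose ?J *v dcoord d h ?y) \<bullet> v" for v
    using dcoord_deriv[OF h c(1) chart_map_in[OF c(2)], of v]
      inner_matrix_vector_transpose[of ?J v "dcoord d h ?y"] by (simp add: inner_commute)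
  then show ?thesis using vector_eq_rdot by metis
qed

lemma gradient_eq: "gradient g h c p = matrix_inv (g c p) *v dcoord c h (chart_map c p)"
  by (simp add: gradient_def partial_deriv_def dcoord_def)

text \<open>With \<open>J\<close> the Jacobian of the change of charts, covectors transform with the transpose of
\<open>J\<close>, the metric as \<open>g\<^sub>c = J\<^sup>T g\<^sub>d J\<close> and the tensor as \<open>T\<^sub>d J = J T\<^sub>c\<close>. Hence \<open>J\<close> maps the
gradient in one chart to the gradient in the other, and the two pairings agree.\<close>

lemma chart_pairing_independent:
  assumes w: "C1_fun w" and v: "C1_fun v"
    and c: "c \<in> \<A>" "p \<in> chart_dom c" and d: "d \<in> \<A>" "p \<in> chart_dom d"
  shows "(coef c (chart_map c p) *v dcoord c w (chart_map c p)) \<bullet> dcoord c v (chart_map c p) =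
    (coef d (chart_map d p) *v dcoord d w (chart_map d p)) \<bullet> dcoord d v (chart_map d p)"
proof -
  define J where "J = transition_jacobian c d p"
  define W where "W = dcoord d w (chart_map d p)"
  define V where "V = dcoord d v (chart_map d p)"
  define y where "y = matrix_inv (g c p) *v (transpose J *v W)"
  have gc: "g c p = transpose J ** g d p ** J"
    using metric_tensor c d unfolding tensor02_def J_def by blast
  have Tc: "T d p ** J = J ** T c p"
    using tensor_spd c d unfolding smooth_spd_tensor11_def tensor11_def J_def by blast
  have dc: "det (g c p) \<noteq> 0" and dd: "det (g d p) \<noteq> 0"
    using metric_det_pos[OF c] metric_det_pos[OF d] by simp_all
  have "det (g c p) = det J * det (g d p) * det J" unfolding gc by (simp add: det_mul)
  then have dJ: "det (transpose J) \<noteq> 0" using dc by auto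
  \<comment> \<open>\<open>y\<close> is the gradient in the chart \<open>c\<close>; the next steps show that \<open>J\<close> maps it to the gradient in
    the chart \<open>d\<close>.\<close>
  have "transpose J *v (g d p *v (J *v y)) = g c p *v y"
    by (simp add: gc matrix_vector_mul_assoc matrix_mul_assoc)
  also have "\<dots> = transpose J *v W"
    unfolding y_def by (rule matrix_inv_vector_mult_det_ne_0(1)[OF dc])
  finally have "g d p *v (J *v y) = W"
    using matrix_inv_vector_mult_det_ne_0(2)[OF dJ] by metis
  then have Jy: "J *v y = matrix_inv (g d p) *v W"
    using matrix_inv_vector_mult_det_ne_0(2)[OF dd] by metis
  have "(coef c (chart_map c p) *v dcoord c w (chart_map c p)) \<bullet> dcoord c v (chart_map c p) =
      (T c p *v y) \<bullet> (transpose J *v V)"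
    unfolding coef_def chart_inv_map[OF c] dcoord_transition[OF w c d] dcoord_transition[OF v c d] y_def W_def V_def J_def
    by (simp add: matrix_vector_mul_assoc)
  also have "\<dots> = (J *v (T c p *v y)) \<bullet> V" by (simp add: inner_matrix_vector_transpose)
  also have "J *v (T c p *v y) = T d p *v (J *v y)"
    by (simp add: matrix_vector_mul_assoc Tc)
  also have "\<dots> = coef d (chart_map d p) *v W"
    unfolding coef_def chart_inv_map[OF d] Jy by (simp add: matrix_vector_mul_assoc)
  finally show ?thesis unfolding W_def V_def .
qed

lemma pairing_in_chart:
  assumes w: "C1_fun w" and v: "C1_fun v" and c: "c \<in> \<A>" "p \<in> chart_dom c"
  shows "pairing w v p = (coef c (chart_map c p) *v dcoord c w (chart_map c p)) \<bullet> dcoord c v (chart_map c p)"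
proof -
  have p: "p \<in> topspace M" using c chart_dom_subset by blast
  define d where "d = chart_at \<A> p"
  have d: "d \<in> \<A>" "p \<in> chart_dom d" using chart_at[OF p] by (auto simp: d_def)
  have "det (g d p) \<noteq> 0" using metric_det_pos[OF d] by simp
  then have "pairing w v p = (coef d (chart_map d p) *v dcoord d w (chart_map d p)) \<bullet> dcoord d v (chart_map d p)"
    unfolding tensor_form_def riem_inner_def Let_def tensor_apply_def gradient_eq d_def[symmetric]
      coef_def chart_inv_map[OF d]
    by (simp only: matrix_inv_vector_mult_det_ne_0(1) matrix_vector_mul_assoc[symmetric] not_False_eq_True)
  then show ?thesis using chart_pairing_independent[OF w v c d] by simp
qed

lemma pairing_symmetric:
  assumes "p \<in> topspace M" shows "pairing w v p = pairing v w p"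
proof -
  define d where "d = chart_at \<A> p"
  have d: "d \<in> \<A>" "p \<in> chart_dom d" using chart_at[OF assms] by (auto simp: d_def)
  have "(T d p *v y) \<bullet> (g d p *v z) = (T d p *v z) \<bullet> (g d p *v y)" for y z
  proof -
    have "(T d p *v y) \<bullet> (g d p *v z) = y \<bullet> (g d p *v (T d p *v z))"
      using tensor_spd d unfolding smooth_spd_tensor11_def by blast
    also have "\<dots> = (g d p *v y) \<bullet> (T d p *v z)"
      using metric_symmetric[OF d] by (simp add: inner_matrix_vector_transpose)
    finally show ?thesis by (simp add: inner_commute)
  qed
  then show ?thesis
    unfolding tensor_form_def riem_inner_def Let_def tensor_apply_def d_def[symmetric] .
qed

lemma pairing_nonneg:
  assumes "p \<in> topspace M" shows "0 \<le> pairing w w p"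
proof -
  define d where "d = chart_at \<A> p"
  have d: "d \<in> \<A>" "p \<in> chart_dom d" using chart_at[OF assms] by (auto simp: d_def)
  have "0 \<le> (T d p *v y) \<bullet> (g d p *v y)" for y
  proof (cases "y = 0")
    case False
    then show ?thesis using tensor_spd d unfolding smooth_spd_tensor11_def by (meson less_imp_le)
  qed simp
  then show ?thesis
    unfolding tensor_form_def riem_inner_def Let_def tensor_apply_def d_def[symmetric] .
qed

lemma coef_C1: assumes c: "c \<in> \<A>" shows "C1_on (chart_img c) (\<lambda>x. coef c x $ i $ j)"
proof -
  have "smooth_components \<A> T" using tensor_spd unfolding smooth_spd_tensor11_def by blast
  then have "C1_on (chart_img c) (\<lambda>x. \<Sum>k\<in>UNIV. T c (chart_inv c x) $ i $ k * matrix_inv (g c (chart_inv c x)) $ k $ j)"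
    using metric_det_pos[OF c chart_inv_in]
    by (intro C1_on_sum C1_on_mult component_C1 c C1_on_matrix_inv chart_img_open metric_smooth)
      force+
  then show ?thesis by (simp add: coef_def matrix_matrix_mult_def)
qed

lemma dcoord_C1: "C2_fun w \<Longrightarrow> c \<in> \<A> \<Longrightarrow> C1_on (chart_img c) (\<lambda>x. dcoord c w x $ j)"
  unfolding C2_fun_def dcoord_def by simp

lemma dcoord_continuous: "C1_fun w \<Longrightarrow> c \<in> \<A> \<Longrightarrow> continuous_on (chart_img c) (\<lambda>x. dcoord c w x $ j)"
  unfolding C1_fun_def dcoord_def by (simp add: C1_on_continuous_deriv)

lemma flux_component: "flux c w x $ i = (\<Sum>j\<in>UNIV. (dens c x * coef c x $ i $ j) * dcoord c w x $ j)"
  by (simp add: flux_def matrix_vector_mult_def sum_distrib_left mult.assoc)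

lemma flux_C1: "C2_fun w \<Longrightarrow> c \<in> \<A> \<Longrightarrow> C1_on (chart_img c) (\<lambda>x. flux c w x $ i)"
  unfolding flux_component by (intro C1_on_sum C1_on_mult dens_C1 coef_C1 dcoord_C1)

lemma chart_operator_continuous:
  assumes "C2_fun w" "c \<in> \<A>" shows "continuous_on (chart_img c) (chart_operator c w)"
  unfolding chart_operator_def
  by (intro continuous_intros C1_on_continuous_deriv flux_C1 C1_on_continuous dens_C1 assms ballI
      less_imp_neq[THEN not_sym] dens_pos)

text \<open>The product rule separates the coefficients from the derivatives of \<open>w\<close>. This is what
makes the operator continuous in space and time jointly when \<open>w\<close> depends on time.\<close>

lemma chart_operator_formula:
  assumes w: "C2_fun w" and c: "c \<in> \<A>" and x: "x \<in> chart_img c"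
  shows "chart_operator c w x = (\<Sum>i\<in>UNIV. \<Sum>j\<in>UNIV.
      (dens c x * coef c x $ i $ j) * frechet_derivative (\<lambda>y. dcoord c w y $ j) (at x) (axis i 1) +
      frechet_derivative (\<lambda>y. dens c y * coef c y $ i $ j) (at x) (axis i 1) * dcoord c w x $ j) / dens c x"
proof -
  have "((\<lambda>y. flux c w y $ i) has_derivative (\<lambda>v. \<Sum>j\<in>UNIV.
      (dens c x * coef c x $ i $ j) * frechet_derivative (\<lambda>y. dcoord c w y $ j) (at x) v +
      frechet_derivative (\<lambda>y. dens c y * coef c y $ i $ j) (at x) v * dcoord c w x $ j)) (at x)" for i
    unfolding flux_component
    by (intro has_derivative_sum has_derivative_mult C1_onD[OF _ x] C1_on_mult dens_C1 coef_C1 dcoord_C1 w c)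
  then have "frechet_derivative (\<lambda>y. flux c w y $ i) (at x) = (\<lambda>v. \<Sum>j\<in>UNIV.
      (dens c x * coef c x $ i $ j) * frechet_derivative (\<lambda>y. dcoord c w y $ j) (at x) v +
      frechet_derivative (\<lambda>y. dens c y * coef c y $ i $ j) (at x) v * dcoord c w x $ j)" for i
    by (rule frechet_derivative_has_derivative)
  then show ?thesis unfolding chart_operator_def by simp
qed

lemma operator_chart_at:
  assumes p: "p \<in> topspace M"
  shows "L w p = chart_operator (chart_at \<A> p) w (chart_map (chart_at \<A> p) p)"
proof -
  define c where "c = chart_at \<A> p"
  have c: "c \<in> \<A>" "p \<in> chart_dom c" using chart_at[OF p] by (auto simp: c_def)
  let ?x = "chart_map c p"
  have e: "partial_deriv c i (\<lambda>q. volume_density g c q * (exp (- f q) *\<^sub>R tensor_apply T (gradient g w) c q) $ i) p =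
      frechet_derivative (\<lambda>y. flux c w y $ i) (at ?x) (axis i 1)" for i
  proof -
    have "frechet_derivative ((\<lambda>q. volume_density g c q * (exp (- f q) *\<^sub>R tensor_apply T (gradient g w) c q) $ i) \<circ> chart_inv c) (at ?x) =
      frechet_derivative (\<lambda>y. flux c w y $ i) (at ?x)"
    proof (rule frechet_derivative_cong_open[OF chart_img_open[OF c(1)] chart_map_in[OF c(2)]])
      fix y assume y: "y \<in> chart_img c"
      show "((\<lambda>q. volume_density g c q * (exp (- f q) *\<^sub>R tensor_apply T (gradient g w) c q) $ i) \<circ> chart_inv c) y = flux c w y $ i"
        by (simp add: flux_def dens_def rho_def coef_def tensor_apply_def gradient_eq chart_map_inv[OF y]
            matrix_vector_mul_assoc)
    qed
    then show ?thesis by (simp add: partial_deriv_def)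
  qed
  have "volume_density g c p > 0" using rho_pos[OF c(1) chart_map_in[OF c(2)]]
    by (simp add: rho_def chart_inv_map[OF c])
  then show ?thesis
    unfolding weighted_operator_def weighted_divergence_def divergence_def Let_def c_def[symmetric] e
      chart_operator_def dens_def rho_def chart_inv_map[OF c]
    by (simp add: exp_minus field_simps)
qed

section \<open>Green's identity and independence of the chart\<close>

lemma pairing_continuous:
  assumes "C1_fun w" "C1_fun v" shows "continuous_map M euclideanreal (pairing w v)"
proof (rule continuous_map_chartsI)
  fix c assume c: "c \<in> \<A>"
  have "continuous_on (chart_img c) (\<lambda>x. \<Sum>i\<in>UNIV. (\<Sum>j\<in>UNIV. coef c x $ i $ j * dcoord c w x $ j) * dcoord c v x $ i)"
    by (intro continuous_intros dcoord_continuous assms c C1_on_continuous coef_C1)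
  then show "continuous_on (chart_img c) (pairing w v \<circ> chart_inv c)"
  proof (rule continuous_on_eq)
    fix x assume x: "x \<in> chart_img c"
    show "(\<Sum>i\<in>UNIV. (\<Sum>j\<in>UNIV. coef c x $ i $ j * dcoord c w x $ j) * dcoord c v x $ i) = (pairing w v \<circ> chart_inv c) x"
      unfolding o_def pairing_in_chart[OF assms c chart_inv_in[OF x]] chart_map_inv[OF x]
      by (simp add: inner_vec_def matrix_vector_mult_def)
  qed
qed

lemma pairing_eq_0_off_support:
  assumes w: "C1_fun w" and v: "C1_fun v"
    and K: "compactin M K" "\<And>p. p \<in> topspace M \<Longrightarrow> p \<notin> K \<Longrightarrow> v p = 0"
    and p: "p \<in> topspace M" "p \<notin> K"
  shows "pairing w v p = 0"
proof -
  obtain d where d: "d \<in> \<A>" "p \<in> chart_dom d" using topspace_chart[OF p(1)] by blast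
  have "closedin M K" by (rule compactin_imp_closedin[OF hausdorff K(1)])
  then have o: "openin M (topspace M - K)" by blast
  have "dcoord d v (chart_map d p) = dcoord d (\<lambda>_. 0) (chart_map d p)"
    by (rule dcoord_cong[OF d(1) chart_map_in[OF d(2)] o]) (use p K chart_inv_map[OF d] in auto)
  also have "\<dots> = 0" by (simp add: dcoord_def o_def vec_eq_iff)
  finally show ?thesis by (simp add: pairing_in_chart[OF w v d])
qed

text \<open>The second factor makes sense on one chart domain only; off the support of the first
factor the product is zero.\<close>

lemma supported_product_continuous:
  assumes v: "continuous_map M euclideanreal v" and c: "c \<in> \<A>"
    and K: "compactin M K" "K \<subseteq> chart_dom c" "\<And>p. p \<in> topspace M \<Longrightarrow> p \<notin> K \<Longrightarrow> v p = 0"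
    and k: "continuous_on (chart_img c) k"
  shows "continuous_map M euclideanreal (\<lambda>p. v p * k (chart_map c p))"
proof (rule continuous_map_chartsI)
  fix d assume d: "d \<in> \<A>"
  let ?O = "chart_map d ` (chart_dom d \<inter> chart_dom c)"
  let ?N = "chart_map d ` (chart_dom d \<inter> (topspace M - K))"
  let ?F = "(\<lambda>p. v p * k (chart_map c p)) \<circ> chart_inv d"
  have "closedin M K" by (rule compactin_imp_closedin[OF hausdorff K(1)])
  then have oN: "open ?N"
    by (intro chart_map_image_open[OF d] openin_Int chart_dom_open d) auto
  have vd: "continuous_on ?O (v \<circ> chart_inv d)"
  proof -
    have "continuous_on (chart_img d) (v \<circ> chart_inv d)"
      unfolding continuous_on_open_vimage[OF chart_img_open[OF d]]
    proof (intro allI impI)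
      fix S :: "real set" assume "open S"
      then have "openin M {p \<in> topspace M. v p \<in> S}" using v unfolding continuous_map_def by simp
      then have "openin M ({p \<in> topspace M. v p \<in> S} \<inter> chart_dom d)"
        by (rule openin_Int[OF _ chart_dom_open[OF d]])
      then have "open (chart_map d ` ({p \<in> topspace M. v p \<in> S} \<inter> chart_dom d))"
        by (rule chart_map_image_open[OF d]) simp
      moreover have "chart_map d ` ({p \<in> topspace M. v p \<in> S} \<inter> chart_dom d) = (v \<circ> chart_inv d) -` S \<inter> chart_img d"
        using chart_inv_map[OF d] chart_dom_subset[OF d] by (auto simp: chart_img_def)
      ultimately show "open ((v \<circ> chart_inv d) -` S \<inter> chart_img d)" by simp
    qed
    then show ?thesis by (rule continuous_on_subset) (auto simp: chart_img_def)
  qed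
  have "continuous_on ?O (\<lambda>x. k (transition d c x))"
    by (rule continuous_on_compose2[OF k C1_on_continuous[OF transition_C1(2)[OF d c]]])
      (use chart_inv_map[OF d] in \<open>auto simp: transition_def chart_img_def\<close>)
  with vd have "continuous_on ?O (\<lambda>x. (v \<circ> chart_inv d) x * k (transition d c x))"
    by (intro continuous_intros)
  then have 1: "continuous_on ?O ?F" by (simp add: transition_def o_def)
  have "continuous_on ?N (\<lambda>x. 0::real)" by simp
  then have 2: "continuous_on ?N ?F"
    by (rule continuous_on_eq) (use K(3) chart_inv_map[OF d] in auto)
  have "chart_img d = ?O \<union> ?N" unfolding chart_img_def using chart_dom_subset[OF d] K(2) by blast
  then show "continuous_on (chart_img d) ?F"
    using continuous_on_open_Un[OF transition_C1(1)[OF d c] oN 1 2] by simp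
qed

text \<open>In the chart, the integrand times the density is the divergence of \<open>v\<close> times the flux of
\<open>w\<close>, a \<open>C\<^sup>1\<close> vector field with compact support.\<close>

lemma green_in_chart:
  assumes w: "C2_fun w" and v: "C1_fun v" and c: "c \<in> \<A>"
    and K: "compactin M K" "K \<subseteq> chart_dom c" "\<And>p. p \<in> topspace M \<Longrightarrow> p \<notin> K \<Longrightarrow> v p = 0"
  shows "continuous_map M euclideanreal (\<lambda>p. v p * chart_operator c w (chart_map c p))"
    and "(\<integral>p. pairing w v p + v p * chart_operator c w (chart_map c p) \<partial>\<mu>) = 0"
proof -
  let ?F = "\<lambda>p. pairing w v p + v p * chart_operator c w (chart_map c p)"
  show cm: "continuous_map M euclideanreal (\<lambda>p. v p * chart_operator c w (chart_map c p))"
    by (rule supported_product_continuous[OF C1_fun_continuous_map[OF v] c K chart_operator_continuous[OF w c]])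
  have w1: "C1_fun w" by (rule C2_fun_C1[OF w])
  have cF: "continuous_map M euclideanreal ?F"
    by (intro continuous_map_add pairing_continuous w1 v cm)
  \<comment> \<open>The components of \<open>v\<close> times the flux, extended by zero to the whole space. In the chart
    image, their divergence is \<open>dens c\<close> times the integrand.\<close>
  define h where "h i x = (if x \<in> chart_img c then v (chart_inv c x) * flux c w x $ i else 0)"
    for i x
  let ?K = "chart_map c ` K"
  have cK: "compact ?K" by (rule chart_map_image_compact[OF c K(1,2)])
  have KV: "?K \<subseteq> chart_img c" using K(2) by (auto simp: chart_img_def)
  have v0: "v (chart_inv c x) = 0" if "x \<in> chart_img c" "x \<notin> ?K" for x
  proof (rule K(3))
    show "chart_inv c x \<in> topspace M" using chart_inv_in[OF that(1)] chart_dom_subset[OF c] by blast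
    show "chart_inv c x \<notin> K" using that chart_map_inv by (metis imageI)
  qed
  have vC: "C1_on (chart_img c) (\<lambda>x. v (chart_inv c x))" using v c unfolding C1_fun_def o_def
    by blast
  have hC: "C1_on UNIV (h i)" for i unfolding h_def
    by (rule C1_on_extend_by_zero[OF _ chart_img_open[OF c] compact_imp_closed[OF cK] KV])
      (use v0 in \<open>auto intro!: C1_on_mult vC flux_C1 w c\<close>)
  have h0: "h i x = 0" if "x \<notin> ?K" for i x using v0 that by (simp add: h_def)
  have "(\<integral>p. ?F p \<partial>\<mu>) = (\<integral>x. indicator (chart_img c) x * dens c x * ?F (chart_inv c x) \<partial>lborel)"
  proof (rule integral_in_chart[OF c continuous_measurable[OF cF]])
    fix p assume p: "p \<in> topspace M" "p \<notin> chart_dom c"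
    then have "p \<notin> K" using K(2) by blast
    then show "?F p = 0" using pairing_eq_0_off_support[OF w1 v K(1,3) p(1)] K(3)[OF p(1)] by simp
  qed
  also have "\<dots> = (\<integral>x. (\<Sum>i\<in>UNIV. frechet_derivative (h i) (at x) (axis i 1)) \<partial>lborel)"
  proof (intro Bochner_Integration.integral_cong refl)
    fix x :: "real^'n"
    show "indicator (chart_img c) x * dens c x * ?F (chart_inv c x) = (\<Sum>i\<in>UNIV. frechet_derivative (h i) (at x) (axis i 1))"
    proof (cases "x \<in> chart_img c")
      case False
      then have x: "x \<in> - ?K" using KV by blast
      have "frechet_derivative (h i) (at x) = frechet_derivative (\<lambda>_. 0) (at x)" for i
        by (rule frechet_derivative_cong_open[OF _ x]) (use h0 compact_imp_closed[OF cK] in auto)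
      then show ?thesis using False by simp
    next
      case True
      have "frechet_derivative (h i) (at x) (axis i 1) =
        v (chart_inv c x) * frechet_derivative (\<lambda>y. flux c w y $ i) (at x) (axis i 1) + dcoord c v x $ i * flux c w x $ i" for i
      proof -
        have "((\<lambda>x. v (chart_inv c x) * flux c w x $ i) has_derivative
            (\<lambda>e. v (chart_inv c x) * frechet_derivative (\<lambda>y. flux c w y $ i) (at x) e +
              frechet_derivative (\<lambda>y. v (chart_inv c y)) (at x) e * flux c w x $ i)) (at x)"
          by (rule has_derivative_mult[OF C1_onD[OF vC True] C1_onD[OF flux_C1[OF w c] True]])
        then have "(h i has_derivative
            (\<lambda>e. v (chart_inv c x) * frechet_derivative (\<lambda>y. flux c w y $ i) (at x) e +
              frechet_derivative (\<lambda>y. v (chart_inv c y)) (at x) e * flux c w x $ i)) (at x)"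
          by (rule has_derivative_transform_within_open[OF _ chart_img_open[OF c] True]) (simp add: h_def)
        then show ?thesis by (simp add: frechet_derivative_has_derivative dcoord_def o_def)
      qed
      then have "(\<Sum>i\<in>UNIV. frechet_derivative (h i) (at x) (axis i 1)) =
        v (chart_inv c x) * (dens c x * chart_operator c w x) + dens c x * ((coef c x *v dcoord c w x) \<bullet> dcoord c v x)"
        using dens_pos[OF c True]
        by (simp add: sum.distrib chart_operator_def sum_distrib_left[symmetric])
          (simp add: flux_def inner_vec_def sum_distrib_left mult_ac)
      also have "\<dots> = indicator (chart_img c) x * dens c x * ?F (chart_inv c x)"
        using True
          by (simp add: pairing_in_chart[OF w1 v c chart_inv_in[OF True]] chart_map_inv[OF True] algebra_simps)
      finally show ?thesis by simp
    qed
  qed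
  also have "\<dots> = (\<Sum>i\<in>UNIV. \<integral>x. frechet_derivative (h i) (at x) (axis i 1) \<partial>lborel)"
    by (rule Bochner_Integration.integral_sum)
      (rule integral_partial_derivative_compact_support(1)[OF hC cK h0])
  also have "\<dots> = 0" by (simp add: integral_partial_derivative_compact_support(2)[OF hC cK h0])
  finally show "(\<integral>p. ?F p \<partial>\<mu>) = 0" .
qed

text \<open>Two charts give the same operator on their overlap, by duality: if the inequality failed,
it would fail on an open set, and testing Green's identity in both charts with a bump supported
there would give a contradiction. Exchanging the charts gives the reverse inequality.\<close>

lemma chart_operator_le:
  assumes w: "C2_fun w" and c: "c \<in> \<A>" "p \<in> chart_dom c" and d: "d \<in> \<A>" "p \<in> chart_dom d"
  shows "chart_operator c w (chart_map c p) \<le> chart_operator d w (chart_map d p)"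
proof (rule ccontr)
  assume neg: "\<not> ?thesis"
  let ?c = "\<lambda>q. chart_operator c w (chart_map c q)"
    and ?d = "\<lambda>q. chart_operator d w (chart_map d q)"
  let ?O = "chart_map c ` (chart_dom c \<inter> chart_dom d)"
  let ?k = "\<lambda>x. chart_operator c w x - chart_operator d w (transition c d x)"
  \<comment> \<open>The open set of all points at which the inequality fails, in coordinates and on the
    manifold.\<close>
  define S where "S = {x \<in> ?O. ?k x \<in> {0<..}}"
  define E where "E = chart_inv c ` S"
  have Oc: "?O \<subseteq> chart_img c" by (auto simp: chart_img_def)
  have "continuous_on ?O ?k"
    by (intro continuous_intros continuous_on_subset[OF chart_operator_continuous[OF w c(1)] Oc]
      continuous_on_compose2[OF chart_operator_continuous[OF w d(1)] C1_on_continuous[OF transition_C1(2)[OF c(1) d(1)]]])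
      (use chart_inv_map[OF c(1)] in \<open>auto simp: transition_def chart_img_def\<close>)
  then have "open (?O \<inter> ?k -` {0<..})"
    by (rule continuous_open_preimage[OF _ transition_C1(1)[OF c(1) d(1)] open_greaterThan])
  moreover have "?O \<inter> ?k -` {0<..} = S" by (auto simp: S_def)
  ultimately have oS: "open S" by simp
  have oE: "openin M E" unfolding E_def
    by (rule chart_inv_image_open[OF c(1) oS]) (use Oc in \<open>auto simp: S_def\<close>)
  have E: "q \<in> E \<longleftrightarrow> q \<in> chart_dom c \<inter> chart_dom d \<and> ?d q < ?c q" for q
  proof
    assume "q \<in> E"
    then show "q \<in> chart_dom c \<inter> chart_dom d \<and> ?d q < ?c q"
      using chart_inv_map[OF c(1)] by (auto simp: E_def S_def transition_def)
  next
    assume q: "q \<in> chart_dom c \<inter> chart_dom d \<and> ?d q < ?c q"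
    then have "chart_map c q \<in> S" using chart_inv_map[OF c(1)] by (auto simp: S_def transition_def)
    then show "q \<in> E" using chart_inv_map[OF c(1), of q] q unfolding E_def by (metis IntD1 imageI)
  qed
  have Ec: "E \<subseteq> chart_dom c" and Ed: "E \<subseteq> chart_dom d" using E by auto
  have pE: "p \<in> E" using E neg c d by auto
  obtain b K where b: "C1_fun b" "\<And>q. b q \<ge> 0" "b p > 0" "compactin M K" "K \<subseteq> E"
    "\<And>q. q \<in> topspace M \<Longrightarrow> q \<notin> K \<Longrightarrow> b q = 0"
    using bump_function[OF c(1) oE Ec pE] by blast
  have Kc: "K \<subseteq> chart_dom c" and Kd: "K \<subseteq> chart_dom d" using b(5) Ec Ed by auto
  note gc = green_in_chart[OF w b(1) c(1) b(4) Kc b(6)]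
  note gd = green_in_chart[OF w b(1) d(1) b(4) Kd b(6)]
  note pc = continuous_integrable[OF pairing_continuous[OF C2_fun_C1[OF w] b(1)]]
  \<comment> \<open>Both chart operators satisfy Green's identity against the bump \<open>b\<close> with the same left-hand
    side, yet their difference is positive where \<open>b\<close> is.\<close>
  let ?h = "\<lambda>q. b q * ?c q - b q * ?d q"
  have "(\<integral>q. ?h q \<partial>\<mu>) = (\<integral>q. b q * ?c q \<partial>\<mu>) - (\<integral>q. b q * ?d q \<partial>\<mu>)"
    by (intro Bochner_Integration.integral_diff continuous_integrable gc(1) gd(1))
  also have "\<dots> = 0"
    using gc(2) gd(2) pc continuous_integrable[OF gc(1)] continuous_integrable[OF gd(1)] by simp
  finally have "(\<integral>q. ?h q \<partial>\<mu>) = 0" .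
  moreover have "0 < (\<integral>q. ?h q \<partial>\<mu>)"
  proof (rule integral_pos)
    show "continuous_map M euclideanreal ?h" by (intro continuous_map_diff gc(1) gd(1))
    show "p \<in> topspace M" using chart_dom_subset[OF c(1)] c(2) by blast
    have "0 < b p * (?c p - ?d p)" using b(3) neg by (intro mult_pos_pos) auto
    then show "0 < ?h p" by (simp add: algebra_simps)
    fix q assume q: "q \<in> topspace M"
    show "0 \<le> ?h q"
    proof (cases "q \<in> K")
      case True
      then have "0 \<le> b q * (?c q - ?d q)" using b(2,5) E by (intro mult_nonneg_nonneg) auto
      then show ?thesis by (simp add: algebra_simps)
    qed (simp add: b(6) q)
  qed
  ultimately show False by simp
qed

lemma operator_in_chart:
  assumes w: "C2_fun w" and c: "c \<in> \<A>" "p \<in> chart_dom c"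
  shows "L w p = chart_operator c w (chart_map c p)"
proof -
  have p: "p \<in> topspace M" using chart_dom_subset[OF c(1)] c(2) by blast
  show ?thesis unfolding operator_chart_at[OF p]
    by (intro antisym chart_operator_le w c chart_at[OF p])
qed

text \<open>Let \<open>B\<close> be a finite sum of bumps, each supported in one chart, that is positive
everywhere. Then \<open>v\<close> is the sum of the products of these bumps with \<open>v / B\<close>, and the identity in
one chart applies to each product.\<close>

lemma green:
  assumes w: "C2_fun w" and v: "C1_fun v"
  shows "(\<integral>p. pairing w v p \<partial>\<mu>) = - (\<integral>p. v p * L w p \<partial>\<mu>)"
proof -
  have w1: "C1_fun w" by (rule C2_fun_C1[OF w])
  let ?Q = "\<lambda>b U. \<exists>K c. c \<in> \<A> \<and> C1_fun b \<and> (\<forall>p. b p \<ge> 0) \<and> compactin M K \<and> K \<subseteq> chart_dom c \<and>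
     (\<forall>p\<in>topspace M - K. b p = 0) \<and> (\<forall>p\<in>U. b p > 0)"
  have loc: "\<exists>U. openin M U \<and> p \<in> U \<and> (\<exists>b. ?Q b U)" if p: "p \<in> topspace M" for p
  proof -
    obtain c where c: "c \<in> \<A>" "p \<in> chart_dom c" using topspace_chart[OF p] by blast
    obtain b K where b: "C1_fun b" "\<And>q. b q \<ge> 0" "b p > 0" "compactin M K" "K \<subseteq> chart_dom c"
      "\<And>q. q \<in> topspace M \<Longrightarrow> q \<notin> K \<Longrightarrow> b q = 0"
      using bump_function[OF c(1) chart_dom_open[OF c(1)] order_refl c(2)] by blast
    let ?U = "{q \<in> topspace M. b q \<in> {0<..}}"
    have "openin M ?U"
      using C1_fun_continuous_map[OF b(1)] open_greaterThan unfolding continuous_map_def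
      by (metis open_openin)
    moreover have "p \<in> ?U" using p b by simp
    moreover have "?Q b ?U" using b c(1) by (intro exI[of _ K] exI[of _ c]) auto
    ultimately show ?thesis by blast
  qed
  obtain \<U> where \<U>: "finite \<U>" "\<And>U. U \<in> \<U> \<Longrightarrow> openin M U \<and> (\<exists>b. ?Q b U)" "topspace M = \<Union>\<U>"
    using compact_space_finite_cover[where P="\<lambda>U. \<exists>b. ?Q b U", OF compact loc] by blast
  then obtain b where b: "\<And>U. U \<in> \<U> \<Longrightarrow> ?Q (b U) U" by metis
  define B where "B p = (\<Sum>U\<in>\<U>. b U p)" for p
  have bC: "C1_fun (b U)" if "U \<in> \<U>" for U using b[OF that] by blast
  have Bpos: "B p > 0" if p: "p \<in> topspace M" for p
  proof -
    obtain U where U: "U \<in> \<U>" "p \<in> U" using p \<U>(3) by blast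
    then have "0 < b U p" using b by blast
    moreover have "0 \<le> b V p" if "V \<in> \<U>" for V using b[OF that] by blast
    ultimately show ?thesis unfolding B_def using \<U>(1) U(1) by (metis sum_pos2)
  qed
  have BC: "C1_fun B" unfolding B_def[abs_def] by (rule C1_fun_sum) (rule bC)
  define v' where "v' p = v p / B p" for p
  have v'C: "C1_fun v'" unfolding v'_def[abs_def]
    by (rule C1_fun_divide[OF v BC]) (use Bpos in force)
  have split: "v p = (\<Sum>U\<in>\<U>. b U p * v' p)" if "p \<in> topspace M" for p
  proof -
    have "(\<Sum>U\<in>\<U>. b U p * v' p) = B p * v' p" by (simp add: sum_distrib_right B_def)
    then show ?thesis using Bpos[OF that] by (simp add: v'_def)
  qed
  have bv: "C1_fun (\<lambda>p. b U p * v' p)" if "U \<in> \<U>" for U by (rule C1_fun_mult[OF bC[OF that] v'C])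
  have ps: "pairing w v p = (\<Sum>U\<in>\<U>. pairing w (\<lambda>p. b U p * v' p) p)" if p: "p \<in> topspace M" for p
  proof -
    obtain c where c: "c \<in> \<A>" "p \<in> chart_dom c" using topspace_chart[OF p] by blast
    let ?x = "chart_map c p"
    have "dcoord c v ?x = dcoord c (\<lambda>p. \<Sum>U\<in>\<U>. b U p * v' p) ?x"
      by (rule dcoord_cong[OF c(1) chart_map_in[OF c(2)] openin_topspace])
        (use p split chart_inv_map[OF c] in auto)
    also have "\<dots> = (\<Sum>U\<in>\<U>. dcoord c (\<lambda>p. b U p * v' p) ?x)"
      by (rule dcoord_sum[OF bv c(1) chart_map_in[OF c(2)]])
    finally show ?thesis
      by (simp add: pairing_in_chart[OF w1 v c] pairing_in_chart[OF w1 bv c] inner_sum_right)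
  qed
  let ?F = "\<lambda>U p. pairing w (\<lambda>p. b U p * v' p) p + b U p * v' p * L w p"
  have F: "integrable \<mu> (?F U) \<and> (\<integral>p. ?F U p \<partial>\<mu>) = 0" if U: "U \<in> \<U>" for U
  proof -
    obtain K c where K: "c \<in> \<A>" "compactin M K" "K \<subseteq> chart_dom c" "\<forall>p\<in>topspace M - K. b U p = 0"
      using b[OF U] by blast
    have z: "b U p * v' p = 0" if "p \<in> topspace M" "p \<notin> K" for p using K(4) that by simp
    let ?G = "\<lambda>p. pairing w (\<lambda>p. b U p * v' p) p + b U p * v' p * chart_operator c w (chart_map c p)"
    note gr = green_in_chart[OF w bv[OF U] K(1,2,3) z]
    have eq: "?F U p = ?G p" if "p \<in> space \<mu>" for p
    proof (cases "p \<in> K")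
      case True
      then show ?thesis using operator_in_chart[OF w K(1)] K(3) by auto
    next
      case False
      then show ?thesis using z[of p] that by (simp add: space_mu)
    qed
    have 1: "integrable \<mu> ?G"
      by (intro continuous_integrable continuous_map_add pairing_continuous w1 bv[OF U] gr(1))
    have 2: "integrable \<mu> (?F U) \<longleftrightarrow> integrable \<mu> ?G"
      by (rule Bochner_Integration.integrable_cong[OF refl eq])
    have 3: "(\<integral>p. ?F U p \<partial>\<mu>) = (\<integral>p. ?G p \<partial>\<mu>)"
      by (rule Bochner_Integration.integral_cong[OF refl eq])
    show ?thesis by (intro conjI iffD2[OF 2 1] trans[OF 3 gr(2)])
  qed
  have "pairing w v p + v p * L w p = (\<Sum>U\<in>\<U>. ?F U p)" if "p \<in> topspace M" for p
  proof -
    have "(\<Sum>U\<in>\<U>. b U p * v' p * L w p) = v p * L w p"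
      by (simp only: split[OF that] sum_distrib_right)
    then show ?thesis by (simp add: ps[OF that] sum.distrib)
  qed
  then have "(\<integral>p. pairing w v p + v p * L w p \<partial>\<mu>) = (\<integral>p. (\<Sum>U\<in>\<U>. ?F U p) \<partial>\<mu>)"
    by (intro Bochner_Integration.integral_cong refl) (simp add: space_mu)
  also have "\<dots> = 0" using F by (subst Bochner_Integration.integral_sum) auto
  finally have z: "(\<integral>p. pairing w v p + v p * L w p \<partial>\<mu>) = 0" .
  have "continuous_map M euclideanreal (L w)"
  proof (rule continuous_map_chartsI)
    fix c assume c: "c \<in> \<A>"
    show "continuous_on (chart_img c) (L w \<circ> chart_inv c)"
      by (rule continuous_on_eq[OF chart_operator_continuous[OF w c]])
        (simp add: operator_in_chart[OF w c chart_inv_in] chart_map_inv)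
  qed
  then have "integrable \<mu> (\<lambda>p. v p * L w p)"
    using C1_fun_continuous_map[OF v] by (intro continuous_integrable continuous_map_real_mult)
  then show ?thesis using z continuous_integrable[OF pairing_continuous[OF w1 v]] by simp
qed

end

section \<open>Functions depending on time\<close>

locale weighted_evolution = weighted_manifold M \<A> g f T \<nu>
  for M :: "'a topology" and \<A> :: "('a, 'n::finite) chart set" and g :: "('a, 'n) matrix_field"
    and f :: "'a \<Rightarrow> real" and T :: "('a, 'n) matrix_field" and \<nu> :: "'a measure" +
  fixes u :: "'a \<Rightarrow> real \<Rightarrow> real" and a b :: real
  assumes interval: "a < b"
    and u_smooth: "smooth_function_on_interval \<A> a b u"
begin

text \<open>Continuity on the product of the manifold with the interval, expressed in charts so that
it can be read off from smoothness there.\<close>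

definition jointly_continuous :: "('a \<Rightarrow> real \<Rightarrow> real) \<Rightarrow> bool" where
  "jointly_continuous k \<longleftrightarrow> (\<forall>c\<in>\<A>.
     continuous_on (chart_img c \<times> {a..b}) (\<lambda>z. k (chart_inv c (fst z)) (snd z)))"

definition u_t :: "'a \<Rightarrow> real \<Rightarrow> real" where
  "u_t p t = vector_derivative (u p) (at t within {a..b})"

lemma jointly_continuous_add:
  "jointly_continuous k \<Longrightarrow> jointly_continuous l \<Longrightarrow> jointly_continuous (\<lambda>p s. k p s + l p s)"
  unfolding jointly_continuous_def by (auto intro!: continuous_intros)

lemma jointly_continuous_const_time:
  assumes "jointly_continuous k" "t \<in> {a..b}" shows "jointly_continuous (\<lambda>p s. k p t)"
  unfolding jointly_continuous_def
proof
  fix c assume "c \<in> \<A>"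
  then have 1: "continuous_on (chart_img c \<times> {a..b}) (\<lambda>z. k (chart_inv c (fst z)) (snd z))"
    using assms(1) unfolding jointly_continuous_def by blast
  have 2: "continuous_on (chart_img c \<times> {a..b}) (\<lambda>z. (fst z, t))" by (intro continuous_intros)
  have "(\<lambda>z. (fst z, t)) ` (chart_img c \<times> {a..b}) \<subseteq> chart_img c \<times> {a..b}" using assms(2) by auto
  from continuous_on_compose2[OF 1 2 this]
  show "continuous_on (chart_img c \<times> {a..b}) (\<lambda>z. k (chart_inv c (fst z)) t)" by simp
qed

lemma jointly_continuous_slice:
  assumes "jointly_continuous k" "t \<in> {a..b}" shows "continuous_map M euclideanreal (\<lambda>p. k p t)"
proof (rule continuous_map_chartsI)
  fix c assume "c \<in> \<A>"
  then have 1: "continuous_on (chart_img c \<times> {a..b}) (\<lambda>z. k (chart_inv c (fst z)) (snd z))"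
    using assms(1) unfolding jointly_continuous_def by blast
  have 2: "continuous_on (chart_img c) (\<lambda>x. (x, t))" by (intro continuous_intros)
  have "(\<lambda>x. (x, t)) ` chart_img c \<subseteq> chart_img c \<times> {a..b}" using assms(2) by auto
  from continuous_on_compose2[OF 1 2 this]
  show "continuous_on (chart_img c) ((\<lambda>p. k p t) \<circ> chart_inv c)" by (simp add: o_def)
qed

lemma jointly_continuous_time:
  assumes "jointly_continuous k" "p \<in> topspace M" shows "continuous_on {a..b} (k p)"
proof -
  obtain c where c: "c \<in> \<A>" "p \<in> chart_dom c" using topspace_chart[OF assms(2)] by blast
  then have 1: "continuous_on (chart_img c \<times> {a..b}) (\<lambda>z. k (chart_inv c (fst z)) (snd z))"
    using assms(1) unfolding jointly_continuous_def by blast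
  have 2: "continuous_on {a..b} (\<lambda>s. (chart_map c p, s))" by (intro continuous_intros)
  have "(\<lambda>s. (chart_map c p, s)) ` {a..b} \<subseteq> chart_img c \<times> {a..b}" using chart_map_in[OF c(2)]
    by auto
  from continuous_on_compose2[OF 1 2 this] show ?thesis by (simp add: chart_inv_map[OF c])
qed

lemma jointly_continuous_bounded:
  assumes "jointly_continuous k"
  obtains B where "\<And>p s. p \<in> topspace M \<Longrightarrow> s \<in> {a..b} \<Longrightarrow> \<bar>k p s\<bar> \<le> B"
proof -
  have loc: "\<exists>U. openin M U \<and> p \<in> U \<and> (\<exists>B. \<forall>q\<in>U. \<forall>s\<in>{a..b}. \<bar>k q s\<bar> \<le> B)" if p: "p \<in> topspace M"
    for p
  proof -
    obtain c where c: "c \<in> \<A>" "p \<in> chart_dom c" using topspace_chart[OF p] by blast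
    let ?x = "chart_map c p"
    obtain r where r: "r > 0" "cball ?x r \<subseteq> chart_img c"
      using chart_img_open[OF c(1)] chart_map_in[OF c(2)] open_contains_cball by blast
    have br: "ball ?x r \<subseteq> chart_img c" using r ball_subset_cball by blast
    have "continuous_on (cball ?x r \<times> {a..b}) (\<lambda>z. k (chart_inv c (fst z)) (snd z))"
      using assms c(1) r(2) unfolding jointly_continuous_def
      by (meson Sigma_mono continuous_on_subset order_refl)
    then have "bounded ((\<lambda>z. k (chart_inv c (fst z)) (snd z)) ` (cball ?x r \<times> {a..b}))"
      by (intro compact_imp_bounded compact_continuous_image compact_Times) auto
    then obtain B where B: "\<And>z. z \<in> cball ?x r \<times> {a..b} \<Longrightarrow> \<bar>k (chart_inv c (fst z)) (snd z)\<bar> \<le> B"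
      unfolding bounded_iff real_norm_def by (meson imageI)
    have "\<forall>q\<in>chart_inv c ` ball ?x r. \<forall>s\<in>{a..b}. \<bar>k q s\<bar> \<le> B"
      using B by fastforce
    moreover have "p \<in> chart_inv c ` ball ?x r" using chart_inv_map[OF c] r(1)
      by (metis centre_in_ball imageI)
    ultimately show ?thesis using chart_inv_image_open[OF c(1) open_ball br] by blast
  qed
  obtain \<U> where \<U>: "finite \<U>" "\<And>U. U \<in> \<U> \<Longrightarrow> openin M U \<and> (\<exists>B. \<forall>q\<in>U. \<forall>s\<in>{a..b}. \<bar>k q s\<bar> \<le> B)" "topspace M = \<Union>\<U>"
    using compact_space_finite_cover[where P="\<lambda>U. \<exists>B. \<forall>q\<in>U. \<forall>s\<in>{a..b}. \<bar>k q s\<bar> \<le> B", OF compact loc]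
      by blast
  then obtain B where B: "\<And>U q s. U \<in> \<U> \<Longrightarrow> q \<in> U \<Longrightarrow> s \<in> {a..b} \<Longrightarrow> \<bar>k q s\<bar> \<le> B U" by metis
  show ?thesis
  proof (rule that)
    fix p s assume ps: "p \<in> topspace M" "s \<in> {a..b}"
    then obtain U where U: "U \<in> \<U>" "p \<in> U" using \<U>(3) by blast
    have "\<bar>k p s\<bar> \<le> B U" by (rule B[OF U ps(2)])
    also have "\<dots> \<le> (\<Sum>U\<in>\<U>. \<bar>B U\<bar>)"
      using member_le_sum[of U \<U> "\<lambda>U. \<bar>B U\<bar>"] \<U>(1) U(1) by fastforce
    finally show "\<bar>k p s\<bar> \<le> (\<Sum>U\<in>\<U>. \<bar>B U\<bar>)" .
  qed
qed

lemma u_chart_smooth: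
  "c \<in> \<A> \<Longrightarrow> smooth_on (chart_img c \<times> {a..b}) (\<lambda>z. u (chart_inv c (fst z)) (snd z))"
  using u_smooth unfolding smooth_function_on_interval_def by (simp add: case_prod_unfold)

lemma u_C2: assumes t: "t \<in> {a..b}" shows "C2_fun (\<lambda>q. u q t)"
  unfolding C2_fun_def C1_fun_def
proof (intro conjI ballI allI)
  fix c assume c: "c \<in> \<A>"
  show "C1_on (chart_img c) ((\<lambda>q. u q t) \<circ> chart_inv c)"
    using smooth_on_slice_C1[OF u_chart_smooth[OF c] chart_img_open[OF c] interval t]
      by (simp add: o_def)
  fix v
  show "C1_on (chart_img c) (\<lambda>x. frechet_derivative ((\<lambda>q. u q t) \<circ> chart_inv c) (at x) v)"
    using smooth_on_slice_C1[OF smooth_on_slice_derivatives(1)[OF u_chart_smooth[OF c] chart_img_open[OF c] interval]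
        chart_img_open[OF c] interval t, of v] by (simp add: o_def)
qed

lemma u_C1: "t \<in> {a..b} \<Longrightarrow> C1_fun (\<lambda>q. u q t)"
  by (rule C2_fun_C1[OF u_C2])

lemma u_continuous: "jointly_continuous u"
  unfolding jointly_continuous_def by (blast intro: smooth_on_imp_continuous_on u_chart_smooth)

lemma u_t_continuous: "jointly_continuous u_t"
  unfolding jointly_continuous_def
proof
  fix c assume c: "c \<in> \<A>"
  show "continuous_on (chart_img c \<times> {a..b}) (\<lambda>z. u_t (chart_inv c (fst z)) (snd z))"
    using smooth_on_imp_continuous_on[OF smooth_on_slice_derivatives(3)[OF u_chart_smooth[OF c] chart_img_open[OF c] interval]]
    by (simp add: u_t_def)
qed

lemma u_has_time_derivative:
  assumes "p \<in> topspace M" "t \<in> {a..b}"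
  shows "(u p has_vector_derivative u_t p t) (at t within {a..b})"
proof -
  obtain c where c: "c \<in> \<A>" "p \<in> chart_dom c" using topspace_chart[OF assms(1)] by blast
  show ?thesis
    using smooth_on_slice_derivatives(4)[OF u_chart_smooth[OF c(1)] chart_img_open[OF c(1)] interval chart_map_in[OF c(2)] assms(2)]
    by (simp add: chart_inv_map[OF c] u_t_def)
qed

text \<open>All first and second spatial derivatives of \<open>u\<close> in a chart are continuous in space and
time.\<close>

lemma operator_u_continuous: "jointly_continuous (\<lambda>p s. L (\<lambda>q. u q s) p)"
  unfolding jointly_continuous_def
proof
  fix c assume c: "c \<in> \<A>"
  let ?V = "chart_img c" and ?u = "\<lambda>z. \<lambda>q. u q (snd z)"
  note F = u_chart_smooth[OF c] and V = chart_img_open[OF c]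
  have fst_cont: "continuous_on (?V \<times> {a..b}) (\<lambda>z. h (fst z))" if "continuous_on ?V h"
    for h :: "real^'n \<Rightarrow> real"
    by (rule continuous_on_compose2[OF that]) (auto intro: continuous_intros)
  have D1: "continuous_on (?V \<times> {a..b}) (\<lambda>z. dcoord c (?u z) (fst z) $ j)" for j
    using smooth_on_imp_continuous_on[OF smooth_on_slice_derivatives(1)[OF F V interval, of "axis j 1"]]
    by (simp add: dcoord_def o_def)
  have D2: "continuous_on (?V \<times> {a..b}) (\<lambda>z. frechet_derivative (\<lambda>y. dcoord c (?u z) y $ j) (at (fst z)) (axis i 1))" for i j
    using smooth_on_imp_continuous_on[OF smooth_on_slice_derivatives(1)[OF smooth_on_slice_derivatives(1)[OF F V interval, of "axis j 1"] V interval, of "axis i 1"]]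
    by (simp add: dcoord_def o_def)
  have a0: "continuous_on (?V \<times> {a..b}) (\<lambda>z. dens c (fst z))"
    by (rule fst_cont[OF C1_on_continuous[OF dens_C1[OF c]]])
  have a1: "continuous_on (?V \<times> {a..b}) (\<lambda>z. coef c (fst z) $ i $ j)" for i j
    by (rule fst_cont[OF C1_on_continuous[OF coef_C1[OF c]]])
  have a2: "continuous_on (?V \<times> {a..b}) (\<lambda>z. frechet_derivative (\<lambda>y. dens c y * coef c y $ i $ j) (at (fst z)) (axis i 1))" for i j
    by (rule fst_cont[OF C1_on_continuous_deriv[OF C1_on_mult[OF dens_C1[OF c] coef_C1[OF c]]]])
  have "continuous_on (?V \<times> {a..b}) (\<lambda>z. (\<Sum>i\<in>UNIV. \<Sum>j\<in>UNIV.
      (dens c (fst z) * coef c (fst z) $ i $ j) * frechet_derivative (\<lambda>y. dcoord c (?u z) y $ j) (at (fst z)) (axis i 1) +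
      frechet_derivative (\<lambda>y. dens c y * coef c y $ i $ j) (at (fst z)) (axis i 1) * dcoord c (?u z) (fst z) $ j) / dens c (fst z))"
    using dens_pos[OF c] by (intro continuous_intros a0 a1 a2 D1 D2) force
  then show "continuous_on (?V \<times> {a..b}) (\<lambda>z. L (?u z) (chart_inv c (fst z)))"
  proof (rule continuous_on_eq)
    fix z assume "z \<in> ?V \<times> {a..b}"
    then have z: "fst z \<in> ?V" "snd z \<in> {a..b}" by auto
    show "(\<Sum>i\<in>UNIV. \<Sum>j\<in>UNIV.
      (dens c (fst z) * coef c (fst z) $ i $ j) * frechet_derivative (\<lambda>y. dcoord c (?u z) y $ j) (at (fst z)) (axis i 1) +
      frechet_derivative (\<lambda>y. dens c y * coef c y $ i $ j) (at (fst z)) (axis i 1) * dcoord c (?u z) (fst z) $ j) / dens c (fst z)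
      = L (?u z) (chart_inv c (fst z))"
      unfolding operator_in_chart[OF u_C2[OF z(2)] c chart_inv_in[OF z(1)]] chart_map_inv[OF z(1)]
        chart_operator_formula[OF u_C2[OF z(2)] c z(1)] ..
  qed
qed

text \<open>Dominated convergence: by compactness \<open>u_t\<close> and \<open>k\<close> are bounded, and \<open>\<mu>\<close> is finite.\<close>

lemma integral_difference_quotient:
  assumes k: "jointly_continuous k" and t: "t \<in> {a..b}"
  shows "((\<lambda>s. (\<integral>p. (u p s - u p t) * k p s \<partial>\<mu>) / (s - t)) \<longlongrightarrow> (\<integral>p. u_t p t * k p t \<partial>\<mu>)) (at t within {a..b})"
  unfolding tendsto_at_iff_sequentially
proof (intro allI impI)
  fix X :: "nat \<Rightarrow> real" assume X: "\<forall>i. X i \<in> {a..b} - {t}" "X \<longlonglongrightarrow> t"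
  have Xi: "X i \<in> {a..b}" "X i \<noteq> t" for i using X(1) by auto
  have Xf: "filterlim X (at t within {a..b}) sequentially"
    using X by (auto simp: filterlim_at)
  obtain B where B: "\<And>p s. p \<in> topspace M \<Longrightarrow> s \<in> {a..b} \<Longrightarrow> \<bar>u_t p s\<bar> \<le> B"
    using jointly_continuous_bounded[OF u_t_continuous] by blast
  obtain C where C: "\<And>p s. p \<in> topspace M \<Longrightarrow> s \<in> {a..b} \<Longrightarrow> \<bar>k p s\<bar> \<le> C"
    using jointly_continuous_bounded[OF k] by blast
  \<comment> \<open>The integrands are bounded by \<open>B * C\<close> by the mean value inequality.\<close>
  define q where "q i p = (u p (X i) - u p t) / (X i - t) * k p (X i)" for i p
  have "(\<lambda>i. \<integral>p. q i p \<partial>\<mu>) \<longlonglongrightarrow> (\<integral>p. u_t p t * k p t \<partial>\<mu>)"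
  proof (rule integral_dominated_convergence[where w="\<lambda>_. B * C"])
    show "(\<lambda>p. u_t p t * k p t) \<in> borel_measurable \<mu>"
      by (intro borel_measurable_times continuous_measurable_mu jointly_continuous_slice u_t_continuous k t)
    show "q i \<in> borel_measurable \<mu>" for i unfolding q_def
      by (intro borel_measurable_times borel_measurable_divide borel_measurable_diff borel_measurable_const
        continuous_measurable_mu jointly_continuous_slice u_continuous k t Xi)
    show "integrable \<mu> (\<lambda>_. B * C)"
      by (rule finite_measure.integrable_const[OF finite_measure_mu])
    show "AE p in \<mu>. (\<lambda>i. q i p) \<longlonglongrightarrow> u_t p t * k p t"
    proof (intro AE_I2)
      fix p assume "p \<in> space \<mu>"
      then have p: "p \<in> topspace M" by (simp add: space_mu)
      have "((\<lambda>s. (u p s - u p t) / (s - t)) \<longlongrightarrow> u_t p t) (at t within {a..b})"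
        using u_has_time_derivative[OF p t]
        by (simp add: has_real_derivative_iff_has_vector_derivative[symmetric] has_field_derivative_iff)
      moreover have "(k p \<longlongrightarrow> k p t) (at t within {a..b})"
        using jointly_continuous_time[OF k p] t by (simp add: continuous_on_def)
      ultimately have "((\<lambda>s. (u p s - u p t) / (s - t) * k p s) \<longlongrightarrow> u_t p t * k p t) (at t within {a..b})"
        by (rule tendsto_mult)
      from filterlim_compose[OF this Xf] show "(\<lambda>i. q i p) \<longlonglongrightarrow> u_t p t * k p t" by (simp add: q_def)
    qed
    fix i
    show "AE p in \<mu>. norm (q i p) \<le> B * C"
    proof (intro AE_I2)
      fix p assume "p \<in> space \<mu>"
      then have p: "p \<in> topspace M" by (simp add: space_mu)
      have B0: "0 \<le> B" using B[OF p t] by (meson abs_ge_zero order_trans)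
      have "norm (u p (X i) - u p t) \<le> B * norm (X i - t)"
      proof (rule differentiable_bound[where f'="\<lambda>s h. h *\<^sub>R u_t p s", OF convex_closed_interval])
        fix s assume s: "s \<in> {a..b}"
        show "(u p has_derivative (\<lambda>h. h *\<^sub>R u_t p s)) (at s within {a..b})"
          using u_has_time_derivative[OF p s] by (simp add: has_vector_derivative_def)
        show "onorm (\<lambda>h. h *\<^sub>R u_t p s) \<le> B"
          using B[OF p s]
            by (intro onorm_bound B0) (auto simp: abs_mult mult.commute[of B] intro!: mult_left_mono)
      qed (use Xi t in auto)
      then have "\<bar>(u p (X i) - u p t) / (X i - t)\<bar> \<le> B"
        using Xi[of i] by (simp add: abs_divide divide_le_eq)
      then show "norm (q i p) \<le> B * C"
        using C[OF p Xi(1)[of i]] B0 unfolding q_def real_norm_def abs_mult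
          by (intro mult_mono) auto
    qed
  qed
  then show "((\<lambda>s. (\<integral>p. (u p s - u p t) * k p s \<partial>\<mu>) / (s - t)) \<circ> X) \<longlonglongrightarrow> (\<integral>p. u_t p t * k p t \<partial>\<mu>)"
    by (simp add: q_def o_def)
qed

section \<open>The frequency function\<close>

abbreviation "Lu p s \<equiv> L (\<lambda>q. u q s) p"

lemma integrable_slices:
  assumes "jointly_continuous h" "jointly_continuous k" "s \<in> {a..b}" "t \<in> {a..b}"
  shows "integrable \<mu> (\<lambda>p. h p s * k p t)"
  using assms by (intro continuous_integrable continuous_map_real_mult jointly_continuous_slice)

lemma D_eq:
  assumes "s \<in> {a..b}" shows "frequency_D \<A> g T \<mu> u s = (\<integral>p. u p s * Lu p s \<partial>\<mu>)"
  unfolding frequency_D_def using green[OF u_C2[OF assms] u_C1[OF assms]] by simp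

text \<open>The mixed terms \<open>\<integral> u(s) L u(t)\<close> and \<open>\<integral> u(t) L u(s)\<close> cancel, since by Green's identity both
are minus the integral of the symmetric pairing of the two gradients.\<close>

lemma D_difference:
  assumes s: "s \<in> {a..b}" and t: "t \<in> {a..b}"
  shows "frequency_D \<A> g T \<mu> u s - frequency_D \<A> g T \<mu> u t = (\<integral>p. (u p s - u p t) * (Lu p s + Lu p t) \<partial>\<mu>)"
proof -
  have "(\<integral>p. u p s * Lu p t \<partial>\<mu>) = - (\<integral>p. pairing (\<lambda>q. u q t) (\<lambda>q. u q s) p \<partial>\<mu>)"
    using green[OF u_C2[OF t] u_C1[OF s]] by simp
  also have "\<dots> = - (\<integral>p. pairing (\<lambda>q. u q s) (\<lambda>q. u q t) p \<partial>\<mu>)"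
    by (intro arg_cong[of _ _ uminus] Bochner_Integration.integral_cong refl pairing_symmetric) (simp add: space_mu)
  also have "\<dots> = (\<integral>p. u p t * Lu p s \<partial>\<mu>)"
    using green[OF u_C2[OF s] u_C1[OF t]] by simp
  finally have sym: "(\<integral>p. u p s * Lu p t \<partial>\<mu>) = (\<integral>p. u p t * Lu p s \<partial>\<mu>)" .
  note i = integrable_slices[OF u_continuous operator_u_continuous]
  have "(\<integral>p. (u p s - u p t) * (Lu p s + Lu p t) \<partial>\<mu>) =
      (\<integral>p. u p s * Lu p s + u p s * Lu p t - (u p t * Lu p s + u p t * Lu p t) \<partial>\<mu>)"
    by (intro Bochner_Integration.integral_cong refl) (simp add: algebra_simps)
  also have "\<dots> = (\<integral>p. u p s * Lu p s \<partial>\<mu>) + (\<integral>p. u p s * Lu p t \<partial>\<mu>) -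
      ((\<integral>p. u p t * Lu p s \<partial>\<mu>) + (\<integral>p. u p t * Lu p t \<partial>\<mu>))"
    by (simp add: i[OF s s] i[OF s t] i[OF t s] i[OF t t])
  finally show ?thesis unfolding D_eq[OF s] D_eq[OF t] using sym by linarith
qed

lemma I_difference:
  assumes s: "s \<in> {a..b}" and t: "t \<in> {a..b}"
  shows "frequency_I \<mu> u s - frequency_I \<mu> u t = (\<integral>p. (u p s - u p t) * (u p s + u p t) \<partial>\<mu>)"
proof -
  note i = integrable_slices[OF u_continuous u_continuous]
  have "(\<integral>p. (u p s - u p t) * (u p s + u p t) \<partial>\<mu>) = (\<integral>p. u p s * u p s - u p t * u p t \<partial>\<mu>)"
    by (intro Bochner_Integration.integral_cong refl) (simp add: algebra_simps)
  also have "\<dots> = (\<integral>p. u p s * u p s \<partial>\<mu>) - (\<integral>p. u p t * u p t \<partial>\<mu>)"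
    by (simp add: i[OF s s] i[OF t t])
  finally show ?thesis by (simp add: frequency_I_def power2_eq_square)
qed

text \<open>Covers both integrals: \<open>k = u\<close> for \<open>I\<close> and \<open>k = L u\<close> for \<open>D\<close>.\<close>

lemma has_derivative_of_quadratic:
  assumes k: "jointly_continuous k" and t: "t \<in> {a..b}"
    and diff: "\<And>s. s \<in> {a..b} \<Longrightarrow> \<Phi> s - \<Phi> t = (\<integral>p. (u p s - u p t) * (k p s + k p t) \<partial>\<mu>)"
  shows "(\<Phi> has_real_derivative 2 * (\<integral>p. u_t p t * k p t \<partial>\<mu>)) (at t within {a..b})"
proof -
  have "jointly_continuous (\<lambda>p s. k p s + k p t)"
    by (intro jointly_continuous_add k jointly_continuous_const_time t)
  from integral_difference_quotient[OF this t]
  have "((\<lambda>s. (\<Phi> s - \<Phi> t) / (s - t)) \<longlongrightarrow> (\<integral>p. u_t p t * (k p t + k p t) \<partial>\<mu>)) (at t within {a..b})"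
    by (rule Lim_transform_eventually)
      (use diff in \<open>auto simp: eventually_at_filter intro!: always_eventually\<close>)
  moreover have "(\<integral>p. u_t p t * (k p t + k p t) \<partial>\<mu>) = (\<integral>p. 2 * (u_t p t * k p t) \<partial>\<mu>)"
    by (intro Bochner_Integration.integral_cong refl) (simp add: algebra_simps)
  ultimately show ?thesis by (simp add: has_field_derivative_iff)
qed

lemma D_derivative:
  "t \<in> {a..b} \<Longrightarrow> (frequency_D \<A> g T \<mu> u has_real_derivative 2 * (\<integral>p. u_t p t * Lu p t \<partial>\<mu>)) (at t within {a..b})"
  by (rule has_derivative_of_quadratic[OF operator_u_continuous _ D_difference])

lemma I_derivative:
  "t \<in> {a..b} \<Longrightarrow> (frequency_I \<mu> u has_real_derivative 2 * (\<integral>p. u_t p t * u p t \<partial>\<mu>)) (at t within {a..b})"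
  by (rule has_derivative_of_quadratic[OF u_continuous _ I_difference])

lemma I_pos:
  assumes t: "t \<in> {a..b}" and p: "p \<in> topspace M" "u p t \<noteq> 0" shows "0 < frequency_I \<mu> u t"
  unfolding frequency_I_def power2_eq_square
proof (rule integral_pos[OF _ _ p(1)])
  show "continuous_map M euclideanreal (\<lambda>p. u p t * u p t)"
    by (intro continuous_map_real_mult jointly_continuous_slice[OF u_continuous t])
qed (use p in \<open>auto simp: zero_less_mult_iff linorder_neq_iff\<close>)

lemma D_nonpos: "frequency_D \<A> g T \<mu> u t \<le> 0"
  unfolding frequency_D_def neg_le_0_iff_le
  by (intro integral_nonneg_AE AE_I2 pairing_nonneg) (simp add: space_mu)

lemma cauchy_schwarz:
  assumes h: "continuous_map M euclideanreal h" and k: "continuous_map M euclideanreal k"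
    and pos: "0 < (\<integral>p. h p * h p \<partial>\<mu>)"
  shows "(\<integral>p. h p * k p \<partial>\<mu>)\<^sup>2 \<le> (\<integral>p. h p * h p \<partial>\<mu>) * (\<integral>p. k p * k p \<partial>\<mu>)"
proof -
  let ?P = "\<integral>p. h p * h p \<partial>\<mu>" and ?Q = "\<integral>p. h p * k p \<partial>\<mu>" and ?R = "\<integral>p. k p * k p \<partial>\<mu>"
  have i: "integrable \<mu> (\<lambda>p. h p * h p)" "integrable \<mu> (\<lambda>p. h p * k p)" "integrable \<mu> (\<lambda>p. k p * k p)"
    by (intro continuous_integrable continuous_map_real_mult h k)+
  have "0 \<le> (\<integral>p. (?P * k p - ?Q * h p)\<^sup>2 \<partial>\<mu>)" by (intro integral_nonneg_AE AE_I2) simp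
  also have "\<dots> = (\<integral>p. ?P\<^sup>2 * (k p * k p) - 2 * ?P * ?Q * (h p * k p) + ?Q\<^sup>2 * (h p * h p) \<partial>\<mu>)"
    by (intro Bochner_Integration.integral_cong refl) (simp add: power2_eq_square algebra_simps)
  also have "\<dots> = ?P\<^sup>2 * ?R - 2 * ?P * ?Q * ?Q + ?Q\<^sup>2 * ?P" using i by simp
  also have "\<dots> = ?P * (?P * ?R - ?Q\<^sup>2)" by (simp add: power2_eq_square algebra_simps)
  finally have "0 \<le> ?P * (?P * ?R - ?Q\<^sup>2)" .
  then show ?thesis using pos by (simp add: zero_le_mult_iff)
qed

text \<open>Here \<open>r\<close> stands for \<open>\<psi> t\<close>. The integrals \<open>A\<close>, \<open>X\<close>, \<open>Y\<close>, \<open>Z\<close> of \<open>(L u)\<^sup>2\<close>, \<open>u w\<close>, \<open>w L u\<close>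
and \<open>w\<^sup>2\<close> express the derivative of \<open>D / I\<close>; the Cauchy--Schwarz inequality bounds it from below
by \<open>- Z / (2 I)\<close>.\<close>

lemma log_frequency_derivative:
  assumes t: "t \<in> {a..b}" and nz: "p0 \<in> topspace M" "u p0 t \<noteq> 0"
    and ineq: "\<And>p. p \<in> topspace M \<Longrightarrow> \<bar>u_t p t - Lu p t\<bar> \<le>
      r * (\<bar>u p t\<bar> + sqrt (pairing (\<lambda>q. u q t) (\<lambda>q. u q t) p))"
  shows "\<exists>d. ((\<lambda>s. ln (1 - frequency_U \<A> g T \<mu> u s)) has_real_derivative d) (at t within {a..b}) \<and> d \<le> r\<^sup>2"
proof -
  let ?D = "frequency_D \<A> g T \<mu> u" and ?I = "frequency_I \<mu> u"
  define w where "w p = u_t p t - Lu p t" for p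
  define E where "E p = pairing (\<lambda>q. u q t) (\<lambda>q. u q t) p" for p
  have cu: "continuous_map M euclideanreal (\<lambda>p. u p t)"
    by (rule jointly_continuous_slice[OF u_continuous t])
  have cut: "continuous_map M euclideanreal (\<lambda>p. u_t p t)"
    by (rule jointly_continuous_slice[OF u_t_continuous t])
  have cL: "continuous_map M euclideanreal (\<lambda>p. Lu p t)"
    by (rule jointly_continuous_slice[OF operator_u_continuous t])
  have cw: "continuous_map M euclideanreal w" unfolding w_def by (intro continuous_map_diff cut cL)
  have cE: "continuous_map M euclideanreal E" unfolding E_def
    by (rule pairing_continuous[OF u_C1[OF t] u_C1[OF t]])
  have int: "integrable \<mu> (\<lambda>p. h p * k p)"
    if "continuous_map M euclideanreal h" "continuous_map M euclideanreal k" for h k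
    by (intro continuous_integrable continuous_map_real_mult that)
  have I0: "0 < ?I t" by (rule I_pos[OF t nz])
  have D0: "?D t \<le> 0" by (rule D_nonpos)
  define A X Y Z where "A = (\<integral>p. Lu p t * Lu p t \<partial>\<mu>)" and "X = (\<integral>p. u p t * w p \<partial>\<mu>)"
    and "Y = (\<integral>p. Lu p t * w p \<partial>\<mu>)" and "Z = (\<integral>p. w p * w p \<partial>\<mu>)"
  have ut: "u_t p t = Lu p t + w p" for p by (simp add: w_def)
  have eD: "(\<integral>p. u_t p t * Lu p t \<partial>\<mu>) = A + Y"
  proof -
    have "(\<integral>p. u_t p t * Lu p t \<partial>\<mu>) = (\<integral>p. Lu p t * Lu p t + Lu p t * w p \<partial>\<mu>)"
      by (intro Bochner_Integration.integral_cong refl) (simp add: ut algebra_simps)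
    then show ?thesis using int[OF cL cL] int[OF cL cw] by (simp add: A_def Y_def)
  qed
  have eI: "(\<integral>p. u_t p t * u p t \<partial>\<mu>) = ?D t + X"
  proof -
    have "(\<integral>p. u_t p t * u p t \<partial>\<mu>) = (\<integral>p. u p t * Lu p t + u p t * w p \<partial>\<mu>)"
      by (intro Bochner_Integration.integral_cong refl) (simp add: ut algebra_simps)
    then show ?thesis using int[OF cu cL] int[OF cu cw] by (simp add: D_eq[OF t] X_def)
  qed
  have I_eq: "?I t = (\<integral>p. u p t * u p t \<partial>\<mu>)" by (simp add: frequency_I_def power2_eq_square)
  have CS: "(?D t + X / 2)\<^sup>2 \<le> ?I t * (A + Y + Z / 4)"
  proof -
    \<comment> \<open>Half of the error \<open>w\<close> is added to complete the square: it turns both sides into the terms of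
      the derivative of \<open>D / I\<close>, up to \<open>X\<^sup>2\<close>, which has the good sign, and \<open>Z\<close>.\<close>
    let ?v = "\<lambda>p. Lu p t + w p / 2"
    have cv: "continuous_map M euclideanreal ?v"
    proof -
      have "continuous_map M euclideanreal (\<lambda>p. Lu p t + (1/2) * w p)"
        by (intro continuous_map_add continuous_map_real_mult continuous_map_const[THEN iffD2] cL cw) auto
      then show ?thesis by simp
    qed
    have "(\<integral>p. u p t * ?v p \<partial>\<mu>) = (\<integral>p. u p t * Lu p t + (u p t * w p) / 2 \<partial>\<mu>)"
      by (intro Bochner_Integration.integral_cong refl) (simp add: algebra_simps)
    also have "\<dots> = ?D t + X / 2" using int[OF cu cL] int[OF cu cw] by (simp add: D_eq[OF t] X_def)
    finally have 1: "(\<integral>p. u p t * ?v p \<partial>\<mu>) = ?D t + X / 2" .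
    have "(\<integral>p. ?v p * ?v p \<partial>\<mu>) = (\<integral>p. Lu p t * Lu p t + Lu p t * w p + (w p * w p) / 4 \<partial>\<mu>)"
      by (intro Bochner_Integration.integral_cong refl) (simp add: algebra_simps)
    also have "\<dots> = A + Y + Z / 4"
      using int[OF cL cL] int[OF cL cw] int[OF cw cw] by (simp add: A_def Y_def Z_def)
    finally have 2: "(\<integral>p. ?v p * ?v p \<partial>\<mu>) = A + Y + Z / 4" .
    show ?thesis using cauchy_schwarz[OF cu cv] I0 unfolding 1 2 I_eq[symmetric] by simp
  qed
  have Zle: "Z \<le> 2 * r\<^sup>2 * (?I t - ?D t)"
  proof -
    have "Z \<le> (\<integral>p. 2 * r\<^sup>2 * (u p t * u p t + E p) \<partial>\<mu>)"
      unfolding Z_def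
    proof (intro integral_mono)
      show "integrable \<mu> (\<lambda>p. w p * w p)" by (rule int[OF cw cw])
      show "integrable \<mu> (\<lambda>p. 2 * r\<^sup>2 * (u p t * u p t + E p))"
        using int[OF cu cu] continuous_integrable[OF cE] by simp
      fix p assume "p \<in> space \<mu>"
      then have p: "p \<in> topspace M" by (simp add: space_mu)
      have E0: "0 \<le> E p" unfolding E_def by (rule pairing_nonneg[OF p])
      \<comment> \<open>The bound \<open>(x + y)\<^sup>2 \<le> 2 * (x\<^sup>2 + y\<^sup>2)\<close> produces exactly the constant needed at the end.\<close>
      define x y where "x = \<bar>u p t\<bar>" and "y = sqrt (E p)"
      have "\<bar>w p\<bar> \<le> r * (x + y)" using ineq[OF p] by (simp add: w_def E_def x_def y_def)
      then have "\<bar>w p\<bar>\<^sup>2 \<le> (r * (x + y))\<^sup>2" by (intro power_mono) auto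
      also have "\<dots> = r\<^sup>2 * (2 * (x\<^sup>2 + y\<^sup>2) - (x - y)\<^sup>2)"
        by (simp add: power2_eq_square algebra_simps)
      also have "\<dots> \<le> r\<^sup>2 * (2 * (x\<^sup>2 + y\<^sup>2))" by (intro mult_left_mono) auto
      also have "x\<^sup>2 = u p t * u p t" by (simp add: x_def power2_eq_square)
      also have "y\<^sup>2 = E p" using E0 by (simp add: y_def)
      finally show "w p * w p \<le> 2 * r\<^sup>2 * (u p t * u p t + E p)"
        by (simp add: power2_eq_square algebra_simps)
    qed
    also have "\<dots> = 2 * r\<^sup>2 * (?I t - ?D t)"
      using int[OF cu cu] continuous_integrable[OF cE] unfolding I_eq frequency_D_def E_def by simp
    finally show ?thesis .
  qed
  define U' where "U' = (2 * (A + Y) * ?I t - ?D t * (2 * (?D t + X))) / (?I t * ?I t)"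
  have "((\<lambda>s. ?D s / ?I s) has_real_derivative U') (at t within {a..b})"
    unfolding U'_def using DERIV_divide[OF D_derivative[OF t] I_derivative[OF t]] I0
      by (simp add: eD eI)
  then have dU: "(frequency_U \<A> g T \<mu> u has_real_derivative U') (at t within {a..b})"
    by (simp add: frequency_U_def[abs_def])
  have U1: "1 - frequency_U \<A> g T \<mu> u t = (?I t - ?D t) / ?I t"
    using I0 by (simp add: frequency_U_def diff_divide_distrib)
  have ID: "0 < ?I t - ?D t" using I0 D0 by simp
  then have pos: "0 < 1 - frequency_U \<A> g T \<mu> u t" unfolding U1 using I0 by simp
  have "((\<lambda>s. ln (1 - frequency_U \<A> g T \<mu> u s)) has_real_derivative
      - U' / (1 - frequency_U \<A> g T \<mu> u t)) (at t within {a..b})"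
    using pos by (auto intro!: derivative_eq_intros dU simp: field_simps)
  moreover have "- U' / (1 - frequency_U \<A> g T \<mu> u t) \<le> r\<^sup>2"
  proof -
    have e: "(?D t + X / 2)\<^sup>2 = ?D t * (?D t + X) + X\<^sup>2 / 4"
      by (simp add: power2_eq_square algebra_simps)
    have "(?I t * ?I t) * U' = 2 * (A + Y) * ?I t - ?D t * (2 * (?D t + X))"
      using I0 by (simp add: U'_def)
    also have "\<dots> = 2 * (?I t * (A + Y + Z / 4) - (?D t * (?D t + X) + X\<^sup>2 / 4)) + X\<^sup>2 / 2 - ?I t * Z / 2"
      by (simp add: field_simps)
    also have "\<dots> \<ge> - ?I t * Z / 2"
    proof -
      have "?D t * (?D t + X) + X\<^sup>2 / 4 \<le> ?I t * (A + Y + Z / 4)" using CS unfolding e .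
      moreover have "0 \<le> X\<^sup>2 / 2" by simp
      ultimately have "0 \<le> 2 * (?I t * (A + Y + Z / 4) - (?D t * (?D t + X) + X\<^sup>2 / 4)) + X\<^sup>2 / 2"
        by (intro add_nonneg_nonneg mult_nonneg_nonneg) simp_all
      then show ?thesis by simp
    qed
    finally have "- ?I t * Z / 2 \<le> ?I t * (?I t * U')" by (simp add: mult.assoc)
    then have "?I t * (- Z / 2) \<le> ?I t * (?I t * U')" by simp
    then have "- Z / 2 \<le> ?I t * U'" using I0 by (simp only: mult_le_cancel_left_pos)
    then have "- (?I t * U') \<le> r\<^sup>2 * (?I t - ?D t)" using Zle by simp
    then have "- (?I t * U') / (?I t - ?D t) \<le> r\<^sup>2" using ID
      by (simp add: pos_divide_le_eq del: minus_divide_left[symmetric])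
    then show ?thesis unfolding U1 using I0 by (simp add: mult.commute)
  qed
  ultimately show ?thesis by blast
qed

end

theorem theorem2p3:
  fixes M :: "'a topology"
    and \<A> :: "('a, 'n::finite) chart set"
    and g T :: "('a, 'n) matrix_field"
    and \<nu> \<mu> :: "'a measure"
    and f :: "'a \<Rightarrow> real"
    and u :: "'a \<Rightarrow> real \<Rightarrow> real"
    and \<psi> :: "real \<Rightarrow> real"
    and a b :: real
  assumes "closed_riemannian_manifold M \<A> g"
    and "is_riemannian_measure M \<A> g \<nu>"
    and "smooth_function \<A> f"
    and "\<mu> = weighted_measure \<nu> f"
    and "smooth_spd_tensor11 \<A> g T"
    and "a < b"
    and "smooth_function_on_interval \<A> a b u"
    and "\<forall>t\<in>{a..b}. \<exists>p\<in>topspace M. u p t \<noteq> 0"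
    and "\<forall>p\<in>topspace M. \<forall>t\<in>{a..b}.
           \<bar>vector_derivative (u p) (at t within {a..b})
              - weighted_operator \<A> g f T (\<lambda>q. u q t) p\<bar>
           \<le> \<psi> t * (\<bar>u p t\<bar>
                + sqrt (tensor_form \<A> g T
                    (gradient g (\<lambda>q. u q t)) (gradient g (\<lambda>q. u q t)) p))"
  shows "\<forall>t\<in>{a..b}. \<exists>d.
           ((\<lambda>s. ln (1 - frequency_U \<A> g T \<mu> u s)) has_real_derivative d) (at t within {a..b})
           \<and> (\<psi> t)\<^sup>2 \<ge> d"
proof
  interpret closed_riemannian_manifold M \<A> g by (rule assms(1))
  interpret weighted_evolution M \<A> g f T \<nu> u a b
    by unfold_locales (use assms in auto)
  fix t assume t: "t \<in> {a..b}"
  then obtain p where p: "p \<in> topspace M" "u p t \<noteq> 0" using assms(8) by blast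
  show "\<exists>d. ((\<lambda>s. ln (1 - frequency_U \<A> g T \<mu> u s)) has_real_derivative d) (at t within {a..b})
           \<and> (\<psi> t)\<^sup>2 \<ge> d"
    unfolding assms(4)
    by (rule log_frequency_derivative[OF t p]) (use assms(9) t in \<open>auto simp: u_t_def\<close>)
qed

end
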